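(* Let $n\ge1$ and let $\sigma$ be a nontrivial endomorphism of $\mathrm{Free}_n(\mathcal V)$, with associated maps $\tilde s:\Delta^{n-1}\to\Delta^{n-1}$ and $S:X\to X$. If either of $\tilde s$ (with respect to $\eta$) and $S$ (with respect to $\lambda$) is nonsingular, then so is the other; and in that case the systems $(\Delta^{n-1},\eta,\tilde s)$ and $(X,\lambda,S)$ are isomorphic under $\rho$, i.e. there are Borel sets $A_1\subseteq\Delta^{n-1}$, $A_2\subseteq X$ of full measure with $\tilde s[A_1]\subseteq A_1$, $S[A_2]\subseteq A_2$, and $\rho\restriction A_1$ is a measure-preserving Borel isomorphism onto $A_2$ with $\rho\circ\tilde s=S\circ\rho$ on $A_1$.
   Context: $\mathcal V$ is the variety generated by $M=((0,1],\star,\to,1)$, $\star$ the product of reals, $a\to b=\min\{1,b/a\}$; $\mathrm{Free}_n(\mathcal V)$ is the algebra of functions $(0,1]^n\to(0,1]$ generated by the coordinate projections $x_0,\dots,x_{n-1}$. A filter is the preimage of $1$ under a homomorphism; $X$ is the set of proper prime filters with subbasis $O_a=\{\mathfrak p:a\notin\mathfrak p\}$. $\sigma$ is nontrivial if $\sigma^{-1}[\mathfrak p]$ is proper for every proper prime filter $\mathfrak p$; $S(\mathfrak p)=\sigma^{-1}[\mathfrak p]$. $\pi(p)=\{t:t(p)=1\}$ for $p\in(0,1]^n\setminus\{(1,\dots,1)\}$ and $\lambda(A)=\mathrm{Leb}(\pi^{-1}[A])$. $\Delta^{n-1}=\{u\in(-\infty,0]^n:\sum u_i=-1\}$, $\eta$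 its normalized $(n-1)$-dimensional Lebesgue measure, $\rho(u)=\{t:t(\exp u)=1\}$ (componentwise $\exp$). With $s_i(u)=\log\big(\sigma(x_i)(\exp u)\big)$ for $u\in(-\infty,0]^n$, $\tilde s(u)=-\big(\sum_i s_i(u)\big)^{-1}(s_0(u),\dots,s_{n-1}(u))$. A map $T$ is nonsingular w.r.t. a measure $\mu$ if $\mu(A)=0$ implies $\mu(T^{-1}[A])=0$. *)

theory Defs
  imports "HOL-Analysis.Analysis" "HOL-Algebra.Group"
begin

section \<open>Algebras of type \<open>(\<otimes>, \<leadsto>, \<one>)\<close>\<close>

record 'a hoop = "'a monoid" +
  imp :: "'a \<Rightarrow> 'a \<Rightarrow> 'a" (infixr "\<leadsto>\<index>" 65)

definition is_algebra :: "('a, 'm) hoop_scheme \<Rightarrow> bool" where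
  "is_algebra A \<longleftrightarrow> \<one>\<^bsub>A\<^esub> \<in> carrier A \<and>
     (\<forall>a\<in>carrier A. \<forall>b\<in>carrier A. a \<otimes>\<^bsub>A\<^esub> b \<in> carrier A \<and> a \<leadsto>\<^bsub>A\<^esub> b \<in> carrier A)"

definition hoop_hom :: "('a, 'm) hoop_scheme \<Rightarrow> ('b, 'k) hoop_scheme \<Rightarrow> ('a \<Rightarrow> 'b) set" where
  "hoop_hom A B = {h \<in> carrier A \<rightarrow> carrier B. h \<one>\<^bsub>A\<^esub> = \<one>\<^bsub>B\<^esub> \<and>
     (\<forall>a\<in>carrier A. \<forall>b\<in>carrier A.
        h (a \<otimes>\<^bsub>A\<^esub> b) = h a \<otimes>\<^bsub>B\<^esub> h b \<and> h (a \<leadsto>\<^bsub>A\<^esub> b) = h a \<leadsto>\<^bsub>B\<^esub> h b)}"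

datatype hterm = HVar nat | HOne | HMult hterm hterm | HImp hterm hterm

primrec heval :: "('a, 'm) hoop_scheme \<Rightarrow> (nat \<Rightarrow> 'a) \<Rightarrow> hterm \<Rightarrow> 'a" where
  "heval A e (HVar i) = e i"
| "heval A e HOne = \<one>\<^bsub>A\<^esub>"
| "heval A e (HMult s t) = heval A e s \<otimes>\<^bsub>A\<^esub> heval A e t"
| "heval A e (HImp s t) = heval A e s \<leadsto>\<^bsub>A\<^esub> heval A e t"

definition satisfies :: "('a, 'm) hoop_scheme \<Rightarrow> hterm \<Rightarrow> hterm \<Rightarrow> bool" where
  "satisfies A s t \<longleftrightarrow> (\<forall>e. range e \<subseteq> carrier A \<longrightarrow> heval A e s = heval A e t)"

definition M_alg :: "real hoop" where
  "M_alg = \<lparr>carrier = {0<..1}, mult = (*), one = 1, imp = (\<lambda>a b. min 1 (b / a))\<rparr>"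

text \<open>Membership in the variety generated by \<open>M_alg\<close>, i.e. in the least equational class
  containing it.\<close>

definition in_variety :: "('a, 'm) hoop_scheme \<Rightarrow> bool" where
  "in_variety A \<longleftrightarrow> is_algebra A \<and> (\<forall>s t. satisfies M_alg s t \<longrightarrow> satisfies A s t)"

text \<open>Functions on \<open>D\<close> are extensional, so that equality of elements is equality on \<open>D\<close>.\<close>

definition fun_alg :: "'d set \<Rightarrow> ('a, 'm) hoop_scheme \<Rightarrow> ('d \<Rightarrow> 'a) hoop" where
  "fun_alg D A = \<lparr>carrier = D \<rightarrow>\<^sub>E carrier A,
     mult = (\<lambda>f g. \<lambda>p\<in>D. f p \<otimes>\<^bsub>A\<^esub> g p),
     one = (\<lambda>p\<in>D. \<one>\<^bsub>A\<^esub>),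
     imp = (\<lambda>f g. \<lambda>p\<in>D. f p \<leadsto>\<^bsub>A\<^esub> g p)\<rparr>"

inductive_set gen_carrier :: "('a, 'm) hoop_scheme \<Rightarrow> 'a set \<Rightarrow> 'a set"
  for A :: "('a, 'm) hoop_scheme" and G :: "'a set" where
  gen: "a \<in> G \<Longrightarrow> a \<in> gen_carrier A G"
| one: "\<one>\<^bsub>A\<^esub> \<in> gen_carrier A G"
| mult: "a \<in> gen_carrier A G \<Longrightarrow> b \<in> gen_carrier A G \<Longrightarrow> a \<otimes>\<^bsub>A\<^esub> b \<in> gen_carrier A G"
| imp: "a \<in> gen_carrier A G \<Longrightarrow> b \<in> gen_carrier A G \<Longrightarrow> a \<leadsto>\<^bsub>A\<^esub> b \<in> gen_carrier A G"

section \<open>The free algebra and its prime filters\<close>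

text \<open>Points of \<open>\<real>\<^sup>n\<close> are the elements of \<open>{..<n} \<rightarrow>\<^sub>E UNIV\<close>.\<close>

definition cube :: "nat \<Rightarrow> (nat \<Rightarrow> real) set" where
  "cube n = {..<n} \<rightarrow>\<^sub>E {0<..1}"

definition proj :: "nat \<Rightarrow> nat \<Rightarrow> (nat \<Rightarrow> real) \<Rightarrow> real" where
  "proj n i = (\<lambda>p\<in>cube n. p i)"

definition Free :: "nat \<Rightarrow> ((nat \<Rightarrow> real) \<Rightarrow> real) hoop" where
  "Free n = (fun_alg (cube n) M_alg)
     \<lparr>carrier := gen_carrier (fun_alg (cube n) M_alg) (proj n ` {..<n})\<rparr>"

text \<open>It is no restriction that the codomain \<open>B\<close> lives on the type \<open>'a set\<close>: the image of \<open>A\<close>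
  under any homomorphism is isomorphic to a quotient of \<open>A\<close>, whose elements are subsets
  of \<open>A\<close>.\<close>

definition hoop_filter :: "('a, 'm) hoop_scheme \<Rightarrow> 'a set \<Rightarrow> bool" where
  "hoop_filter A F \<longleftrightarrow> (\<exists>(B :: 'a set hoop) h. in_variety B \<and> h \<in> hoop_hom A B \<and>
     F = {a \<in> carrier A. h a = \<one>\<^bsub>B\<^esub>})"

text \<open>The join of the underlying lattice; in \<open>M_alg\<close> it is the maximum.\<close>

definition hjoin :: "('a, 'm) hoop_scheme \<Rightarrow> 'a \<Rightarrow> 'a \<Rightarrow> 'a" where
  "hjoin A a b = (a \<leadsto>\<^bsub>A\<^esub> b) \<leadsto>\<^bsub>A\<^esub> b"

definition prime_filter :: "('a, 'm) hoop_scheme \<Rightarrow> 'a set \<Rightarrow> bool" where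
  "prime_filter A F \<longleftrightarrow> hoop_filter A F \<and>
     (\<forall>a\<in>carrier A. \<forall>b\<in>carrier A. hjoin A a b \<in> F \<longrightarrow> a \<in> F \<or> b \<in> F)"

definition Spec :: "nat \<Rightarrow> ((nat \<Rightarrow> real) \<Rightarrow> real) set set" where
  "Spec n = {\<pp>. prime_filter (Free n) \<pp> \<and> \<pp> \<noteq> carrier (Free n)}"

definition Spec_top :: "nat \<Rightarrow> ((nat \<Rightarrow> real) \<Rightarrow> real) set topology" where
  "Spec_top n = topology_generated_by ((\<lambda>a. {\<pp> \<in> Spec n. a \<notin> \<pp>}) ` carrier (Free n))"

definition Spec_borel :: "nat \<Rightarrow> ((nat \<Rightarrow> real) \<Rightarrow> real) set measure" where
  "Spec_borel n = sigma (Spec n) {U. openin (Spec_top n) U}"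

definition S_map :: "nat \<Rightarrow> (((nat \<Rightarrow> real) \<Rightarrow> real) \<Rightarrow> (nat \<Rightarrow> real) \<Rightarrow> real)
    \<Rightarrow> ((nat \<Rightarrow> real) \<Rightarrow> real) set \<Rightarrow> ((nat \<Rightarrow> real) \<Rightarrow> real) set" where
  "S_map n \<sigma> \<pp> = {t \<in> carrier (Free n). \<sigma> t \<in> \<pp>}"

definition nontrivial_endo :: "nat \<Rightarrow> (((nat \<Rightarrow> real) \<Rightarrow> real) \<Rightarrow> (nat \<Rightarrow> real) \<Rightarrow> real) \<Rightarrow> bool" where
  "nontrivial_endo n \<sigma> \<longleftrightarrow> \<sigma> \<in> hoop_hom (Free n) (Free n) \<and>
     (\<forall>\<pp>\<in>Spec n. S_map n \<sigma> \<pp> \<noteq> carrier (Free n))"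

definition pi_map :: "nat \<Rightarrow> (nat \<Rightarrow> real) \<Rightarrow> ((nat \<Rightarrow> real) \<Rightarrow> real) set" where
  "pi_map n p = {t \<in> carrier (Free n). t p = 1}"

definition lam :: "nat \<Rightarrow> ((nat \<Rightarrow> real) \<Rightarrow> real) set measure" where
  "lam n = distr (restrict_space (\<Pi>\<^sub>M i\<in>{..<n}. lborel) (cube n - {\<lambda>i\<in>{..<n}. 1}))
     (Spec_borel n) (pi_map n)"

section \<open>The simplex\<close>

definition Delta :: "nat \<Rightarrow> (nat \<Rightarrow> real) set" where
  "Delta n = {u \<in> {..<n} \<rightarrow>\<^sub>E {..0}. (\<Sum>i<n. u i) = -1}"

definition Delta_borel :: "nat \<Rightarrow> (nat \<Rightarrow> real) measure" where
  "Delta_borel n = restrict_space (\<Pi>\<^sub>M i\<in>{..<n}. borel) (Delta n)"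

text \<open>Lebesgue measure of dimension \<open>n - 1\<close> on \<open>Delta n\<close>, transported from \<open>\<real>\<^sup>n\<^sup>-\<^sup>1\<close> by the affine
  chart that recovers the last coordinate from the others. It differs from Euclidean surface
  measure by the constant factor \<open>sqrt n\<close>, which disappears in the normalization.\<close>

definition Delta_chart :: "nat \<Rightarrow> (nat \<Rightarrow> real) \<Rightarrow> nat \<Rightarrow> real" where
  "Delta_chart n v = (\<lambda>i\<in>{..<n}. if i = n - 1 then - 1 - (\<Sum>j<n-1. v j) else v i)"

definition Delta_leb :: "nat \<Rightarrow> (nat \<Rightarrow> real) measure" where
  "Delta_leb n = distr
     (restrict_space (\<Pi>\<^sub>M i\<in>{..<n-1}. lborel)
        {v \<in> {..<n-1} \<rightarrow>\<^sub>E {..0}. - 1 \<le> (\<Sum>j<n-1. v j)})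
     (Delta_borel n) (Delta_chart n)"

definition eta :: "nat \<Rightarrow> (nat \<Rightarrow> real) measure" where
  "eta n = uniform_measure (Delta_leb n) (Delta n)"

definition exp_vec :: "nat \<Rightarrow> (nat \<Rightarrow> real) \<Rightarrow> nat \<Rightarrow> real" where
  "exp_vec n u = (\<lambda>i\<in>{..<n}. exp (u i))"

definition rho :: "nat \<Rightarrow> (nat \<Rightarrow> real) \<Rightarrow> ((nat \<Rightarrow> real) \<Rightarrow> real) set" where
  "rho n u = {t \<in> carrier (Free n). t (exp_vec n u) = 1}"

definition s_map :: "nat \<Rightarrow> (((nat \<Rightarrow> real) \<Rightarrow> real) \<Rightarrow> (nat \<Rightarrow> real) \<Rightarrow> real)
    \<Rightarrow> nat \<Rightarrow> (nat \<Rightarrow> real) \<Rightarrow> real" where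
  "s_map n \<sigma> i u = ln (\<sigma> (proj n i) (exp_vec n u))"

definition s_tilde :: "nat \<Rightarrow> (((nat \<Rightarrow> real) \<Rightarrow> real) \<Rightarrow> (nat \<Rightarrow> real) \<Rightarrow> real)
    \<Rightarrow> (nat \<Rightarrow> real) \<Rightarrow> nat \<Rightarrow> real" where
  "s_tilde n \<sigma> u = (\<lambda>i\<in>{..<n}. - inverse (\<Sum>j<n. s_map n \<sigma> j u) * s_map n \<sigma> i u)"

section \<open>Nonsingularity and isomorphism\<close>

definition nonsingular :: "'a measure \<Rightarrow> ('a \<Rightarrow> 'a) \<Rightarrow> bool" where
  "nonsingular \<mu> T \<longleftrightarrow> (\<forall>A\<in>null_sets \<mu>. T -` A \<inter> space \<mu> \<in> null_sets \<mu>)"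

definition isomorphic_under ::
  "'a measure \<Rightarrow> ('a \<Rightarrow> 'a) \<Rightarrow> 'b measure \<Rightarrow> ('b \<Rightarrow> 'b) \<Rightarrow> ('a \<Rightarrow> 'b) \<Rightarrow> bool" where
  "isomorphic_under \<mu> T \<nu> R \<phi> \<longleftrightarrow> (\<exists>A\<^sub>1\<in>sets \<mu>. \<exists>A\<^sub>2\<in>sets \<nu>.
     space \<mu> - A\<^sub>1 \<in> null_sets \<mu> \<and> space \<nu> - A\<^sub>2 \<in> null_sets \<nu> \<and>
     T ` A\<^sub>1 \<subseteq> A\<^sub>1 \<and> R ` A\<^sub>2 \<subseteq> A\<^sub>2 \<and>
     bij_betw \<phi> A\<^sub>1 A\<^sub>2 \<and>
     \<phi> \<in> restrict_space \<mu> A\<^sub>1 \<rightarrow>\<^sub>M restrict_space \<nu> A\<^sub>2 \<and>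
     the_inv_into A\<^sub>1 \<phi> \<in> restrict_space \<nu> A\<^sub>2 \<rightarrow>\<^sub>M restrict_space \<mu> A\<^sub>1 \<and>
     (\<forall>B\<in>sets \<nu>. B \<subseteq> A\<^sub>2 \<longrightarrow> emeasure \<mu> (\<phi> -` B \<inter> A\<^sub>1) = emeasure \<nu> B) \<and>
     (\<forall>u\<in>A\<^sub>1. \<phi> (T u) = R (\<phi> u)))"

end

theory Submission
  imports Defs
begin

text \<open>In logarithmic coordinates the elements of \<open>Free n\<close> are positively homogeneous, so the filter of
  a point \<open>exp u\<close> depends only on the ray through \<open>u\<close>. Hence \<open>S \<circ> \<rho> = \<rho> \<circ> s~\<close> on the
  whole simplex, and \<open>\<lambda>\<close> is the image of \<open>\<eta>\<close> under \<open>\<rho>\<close>: the substitution \<open>p = exp u\<close>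
  turns Lebesgue measure on the cube into the density \<open>exp (\<Sum> u)\<close>, which is constant on the slices
  \<open>\<Sum> u = -c\<close>, so that its radial projection is a multiple of Lebesgue measure on the simplex; the
  multiple is determined by the total mass. Finally \<open>\<rho>\<close> is a Borel isomorphism onto its range: a
  Borel left inverse \<open>g\<close> is obtained by reading off coordinates as infima over rationals, and the
  range consists of those \<open>P\<close> with \<open>\<rho> (g P) = P\<close>, which amounts to countably many Borel
  conditions as \<open>Free n\<close> is countable. So the two systems are isomorphic on \<open>\<Delta>\<close> and
  \<open>\<rho>[\<Delta>]\<close>, and the equivalence of the two nonsingularity conditions is a matter of transport.\<close>

section \<open>Radial projection of Lebesgue measure\<close>

text \<open>Induction on the index set: Tonelli splits off one coordinate, to which
  \<open>subst\<close> applies. The weights \<open>a\<close> and \<open>b\<close> let one induction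
  serve both scaling (\<open>a = 1\<close>, \<open>b = c\<close>) and \<open>\<phi> = exp\<close>
  (\<open>a\<close> an indicator, \<open>b\<close> an exponential density).\<close>

lemma nn_integral_PiM_subst:
  fixes a b :: "real \<Rightarrow> ennreal" and \<phi> :: "real \<Rightarrow> real"
  assumes [measurable]: "a \<in> borel_measurable borel" "b \<in> borel_measurable borel"
      "\<phi> \<in> borel_measurable borel"
    and subst: "\<And>g. g \<in> borel_measurable borel \<Longrightarrow>
      (\<integral>\<^sup>+x. g x * a x \<partial>lborel) = (\<integral>\<^sup>+y. g (\<phi> y) * b y \<partial>lborel)"
    and "finite I" "f \<in> borel_measurable (Pi\<^sub>M I (\<lambda>_. lborel))"
  shows "(\<integral>\<^sup>+x. f x * (\<Prod>i\<in>I. a (x i)) \<partial>Pi\<^sub>M I (\<lambda>_. lborel)) =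
    (\<integral>\<^sup>+y. f (\<lambda>i\<in>I. \<phi> (y i)) * (\<Prod>i\<in>I. b (y i)) \<partial>Pi\<^sub>M I (\<lambda>_. lborel))"
  using assms(5,6)
proof (induction I arbitrary: f)
  interpret product_sigma_finite "\<lambda>_::'a. lborel :: real measure"
    by unfold_locales
  case empty
  then show ?case
    by (simp add: PiM_empty nn_integral_count_space_finite restrict_def)
next
  interpret product_sigma_finite "\<lambda>_::'a. lborel :: real measure"
    by unfold_locales
  case (insert i I)
  note [measurable] = insert.prems
  have "(\<integral>\<^sup>+x. f x * (\<Prod>j\<in>insert i I. a (x j)) \<partial>Pi\<^sub>M (insert i I) (\<lambda>_. lborel)) =
    (\<integral>\<^sup>+x. \<integral>\<^sup>+z. f (x(i := z)) * (\<Prod>j\<in>insert i I. a ((x(i := z)) j)) \<partial>lborel \<partial>Pi\<^sub>M I (\<lambda>_. lborel))"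
    using insert.hyps by (subst product_nn_integral_insert) auto
  also have "\<dots> = (\<integral>\<^sup>+x. \<integral>\<^sup>+z. f (x(i := z)) * a z * (\<Prod>j\<in>I. a (x j)) \<partial>lborel \<partial>Pi\<^sub>M I (\<lambda>_. lborel))"
  proof (intro nn_integral_cong)
    fix x z
    have "(\<Prod>j\<in>I. a (if j = i then z else x j)) = (\<Prod>j\<in>I. a (x j))"
      using insert.hyps by (intro prod.cong) auto
    then show "f (x(i := z)) * (\<Prod>j\<in>insert i I. a ((x(i := z)) j)) = f (x(i := z)) * a z * (\<Prod>j\<in>I. a (x j))"
      using insert.hyps by (simp add: mult.assoc)
  qed
  also have "\<dots> = (\<integral>\<^sup>+x. (\<integral>\<^sup>+z. f (x(i := z)) * a z \<partial>lborel) * (\<Prod>j\<in>I. a (x j)) \<partial>Pi\<^sub>M I (\<lambda>_. lborel))"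
    by (intro nn_integral_cong nn_integral_multc) measurable
  also have "\<dots> = (\<integral>\<^sup>+x. (\<integral>\<^sup>+z. f (x(i := \<phi> z)) * b z \<partial>lborel) * (\<Prod>j\<in>I. a (x j)) \<partial>Pi\<^sub>M I (\<lambda>_. lborel))"
  proof (intro nn_integral_cong)
    fix x assume [measurable]: "x \<in> space (Pi\<^sub>M I (\<lambda>_. lborel :: real measure))"
    have "(\<lambda>z. f (x(i := z))) \<in> borel_measurable borel" by measurable
    then show "(\<integral>\<^sup>+z. f (x(i := z)) * a z \<partial>lborel) * (\<Prod>j\<in>I. a (x j)) =
       (\<integral>\<^sup>+z. f (x(i := \<phi> z)) * b z \<partial>lborel) * (\<Prod>j\<in>I. a (x j))"
      by (simp add: subst)
  qed
  \<comment> \<open>The induction hypothesis is used for the function of \<open>x\<close> that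
    remains once the new coordinate has been integrated out; this is why \<open>f\<close> is
    arbitrary in the induction.\<close>
  also have "\<dots> = (\<integral>\<^sup>+y. (\<integral>\<^sup>+z. f ((\<lambda>j\<in>I. \<phi> (y j))(i := \<phi> z)) * b z \<partial>lborel) * (\<Prod>j\<in>I. b (y j)) \<partial>Pi\<^sub>M I (\<lambda>_. lborel))"
    by (rule insert.IH) measurable
  also have "\<dots> = (\<integral>\<^sup>+y. \<integral>\<^sup>+z. f ((\<lambda>j\<in>I. \<phi> (y j))(i := \<phi> z)) * b z * (\<Prod>j\<in>I. b (y j)) \<partial>lborel \<partial>Pi\<^sub>M I (\<lambda>_. lborel))"
    by (intro nn_integral_cong nn_integral_multc[symmetric]) measurable
  also have "\<dots> = (\<integral>\<^sup>+y. \<integral>\<^sup>+z. f (\<lambda>j\<in>insert i I. \<phi> ((y(i := z)) j)) * (\<Prod>j\<in>insert i I. b ((y(i := z)) j)) \<partial>lborel \<partial>Pi\<^sub>M I (\<lambda>_. lborel))"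
  proof (intro nn_integral_cong)
    fix y z
    have "(\<Prod>j\<in>I. b (if j = i then z else y j)) = (\<Prod>j\<in>I. b (y j))"
      using insert.hyps by (intro prod.cong) auto
    moreover have "(\<lambda>j\<in>I. \<phi> (y j))(i := \<phi> z) = (\<lambda>j\<in>insert i I. \<phi> ((y(i := z)) j))"
      using insert.hyps by (auto simp: fun_eq_iff)
    ultimately show "f ((\<lambda>j\<in>I. \<phi> (y j))(i := \<phi> z)) * b z * (\<Prod>j\<in>I. b (y j)) =
      f (\<lambda>j\<in>insert i I. \<phi> ((y(i := z)) j)) * (\<Prod>j\<in>insert i I. b ((y(i := z)) j))"
      using insert.hyps by (simp add: mult.assoc)
  qed
  also have "\<dots> = (\<integral>\<^sup>+y. f (\<lambda>j\<in>insert i I. \<phi> (y j)) * (\<Prod>j\<in>insert i I. b (y j)) \<partial>Pi\<^sub>M (insert i I) (\<lambda>_. lborel))"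
    using insert.hyps by (subst product_nn_integral_insert) auto
  finally show ?case .
qed

lemma nn_integral_PiM_scale:
  fixes c :: real
  assumes "finite I" "f \<in> borel_measurable (Pi\<^sub>M I (\<lambda>_. lborel))" "c > 0"
  shows "(\<integral>\<^sup>+x. f x \<partial>Pi\<^sub>M I (\<lambda>_. lborel)) =
    (\<integral>\<^sup>+y. f (\<lambda>i\<in>I. c * y i) \<partial>Pi\<^sub>M I (\<lambda>_. lborel)) * ennreal (c ^ card I)"
proof -
  note [measurable] = assms(2)
  have "(\<integral>\<^sup>+x. f x * (\<Prod>i\<in>I. 1) \<partial>Pi\<^sub>M I (\<lambda>_. lborel)) =
    (\<integral>\<^sup>+y. f (\<lambda>i\<in>I. c * y i) * (\<Prod>i\<in>I. ennreal c) \<partial>Pi\<^sub>M I (\<lambda>_. lborel))"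
  proof (rule nn_integral_PiM_subst)
    fix g :: "real \<Rightarrow> ennreal" assume [measurable]: "g \<in> borel_measurable borel"
    show "(\<integral>\<^sup>+x. g x * 1 \<partial>lborel) = (\<integral>\<^sup>+y. g (c * y) * ennreal c \<partial>lborel)"
      using nn_integral_real_affine[of g c 0] \<open>c > 0\<close>
      by (subst nn_integral_multc) (simp_all add: mult.commute)
  qed (use assms in auto)
  then show ?thesis
    using \<open>c > 0\<close> by (simp add: nn_integral_multc ennreal_power)
qed

section \<open>The substitution \<open>x = exp y\<close> in one variable\<close>

lemma nn_integral_exp_tail:
  "(\<integral>\<^sup>+y. ennreal (exp y) * indicator {..0} y * indicator {x<..} (exp y) \<partial>lborel) =
    ennreal (if x \<le> 1 then 1 - max 0 x else (0::real))" (is "?L = _")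
proof -
  \<comment> \<open>The reflection of \<open>y\<close> to \<open>- y\<close> moves the integral to
    \<open>{0..}\<close>, as the fundamental theorem with a limit at \<open>at_top\<close>
    requires.\<close>
  have "?L = (\<integral>\<^sup>+y. ennreal (exp (- y)) * indicator {0..} y * indicator {x<..} (exp (- y)) \<partial>lborel)"
    by (subst nn_integral_real_affine[where c = "-1" and t = 0])
      (auto intro!: nn_integral_cong split: split_indicator)
  also have "\<dots> = ennreal (if x \<le> 1 then 1 - max 0 x else 0)"
  proof (cases "x > 0")
    case False
    then have "(\<integral>\<^sup>+y. ennreal (exp (- y)) * indicator {0..} y * indicator {x<..} (exp (- y)) \<partial>lborel) =
      (\<integral>\<^sup>+y. ennreal (exp (- y)) * indicator {0..} y \<partial>lborel)"
      by (intro nn_integral_cong) (auto split: split_indicator intro: le_less_trans[OF _ exp_gt_zero])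
    also have "\<dots> = ennreal (0 - (- exp (- 0)))"
    proof (rule nn_integral_FTC_atLeast)
      show "((\<lambda>y::real. - exp (- y)) \<longlongrightarrow> 0) at_top"
        using tendsto_minus[OF filterlim_compose[OF exp_at_bot filterlim_uminus_at_bot_at_top]] by simp
    qed (auto intro!: derivative_eq_intros)
    finally show ?thesis using False by (simp add: max_def)
  next
    case True
    have "(\<integral>\<^sup>+y. ennreal (exp (- y)) * indicator {0..} y * indicator {x<..} (exp (- y)) \<partial>lborel) =
      (\<integral>\<^sup>+y. ennreal (exp (- y)) * indicator {0.. - ln x} y \<partial>lborel)"
    proof (intro nn_integral_cong_AE)
      \<comment> \<open>The condition \<open>x < exp (- y)\<close> means \<open>y < - ln x\<close>,
        so the two integrands differ at most at the endpoint \<open>- ln x\<close>.\<close>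
      show "AE y in lborel. ennreal (exp (- y)) * indicator {0..} y * indicator {x<..} (exp (- y)) =
        ennreal (exp (- y)) * indicator {0.. - ln x} y"
        using AE_lborel_singleton[of "- ln x"]
      proof eventually_elim
        case (elim y)
        have "x < exp (- y) \<longleftrightarrow> ln x < - y"
          using True by (metis exp_less_cancel_iff exp_ln)
        then show ?case using elim by (auto split: split_indicator)
      qed
    qed
    also have "\<dots> = ennreal (if x \<le> 1 then 1 - x else 0)"
    proof (cases "x \<le> 1")
      case x1: True
      have "(\<integral>\<^sup>+y. ennreal (exp (- y)) * indicator {0.. - ln x} y \<partial>lborel) =
        ennreal (- exp (- (- ln x)) - (- exp (- 0)))"
        by (rule nn_integral_FTC_Icc) (use x1 True in \<open>auto intro!: derivative_eq_intros\<close>)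
      then show ?thesis using x1 True by simp
    next
      case False
      then have "{0.. - ln x} = {}" using ln_gt_zero[of x] by auto
      then show ?thesis using False by simp
    qed
    finally show ?thesis using True by (simp add: max_def)
  qed
  finally show ?thesis .
qed

text \<open>Both sides integrate \<open>g\<close> against a finite measure: Lebesgue measure on
  \<open>{0<..1}\<close>, and the image under \<open>exp\<close> of the density \<open>exp y\<close>
  on \<open>{..0}\<close>. The two agree on all half-lines \<open>{x<..}\<close>, hence on all Borel
  sets.\<close>

lemma nn_integral_exp_subst:
  assumes [measurable]: "g \<in> borel_measurable borel"
  shows "(\<integral>\<^sup>+x. g x * indicator {0<..1::real} x \<partial>lborel) =
    (\<integral>\<^sup>+y. g (exp y) * (ennreal (exp y) * indicator {..0} y) \<partial>lborel)"
proof -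
  have "density lborel (indicator {0<..1::real}) =
    distr (density lborel (\<lambda>y. ennreal (exp y) * indicator {..0} y)) borel exp" (is "?M = ?N")
  proof (rule measure_eqI_lessThan)
    fix x :: real
    have M: "emeasure ?M {x<..} = ennreal (if x \<le> 1 then 1 - max 0 x else 0)"
    proof -
      have "emeasure ?M {x<..} = (\<integral>\<^sup>+z. indicator {max 0 x<..1} z \<partial>lborel)"
        by (subst emeasure_density, simp, simp, intro nn_integral_cong) (auto split: split_indicator)
      then show ?thesis by (auto simp: max_def)
    qed
    have "emeasure ?N {x<..} = (\<integral>\<^sup>+y. ennreal (exp y) * indicator {..0} y * indicator {x<..} (exp y) \<partial>lborel)"
      by (simp add: emeasure_distr emeasure_density measurable_sets_borel[of exp] vimage_def indicator_def)
    with M show "emeasure ?M {x<..} = emeasure ?N {x<..}"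
      by (simp only: nn_integral_exp_tail)
    show "emeasure ?M {x<..} < \<infinity>" by (simp only: M) simp
  qed auto
  then have "integral\<^sup>N ?M g = integral\<^sup>N ?N g" by simp
  then show ?thesis
    by (simp add: nn_integral_density nn_integral_distr mult.commute)
qed

section \<open>Polar decomposition of the negative orthant along the coordinate sum\<close>

lemma prod_exp_indicator:
  fixes y :: "'i \<Rightarrow> real"
  assumes "finite I"
  shows "(\<Prod>i\<in>I. ennreal (exp (y i)) * indicator {..0} (y i)) =
    ennreal (exp (\<Sum>i\<in>I. y i)) * indicator {y. \<forall>i\<in>I. y i \<le> 0} y"
  using assms
  by induction (auto simp: exp_add ennreal_mult split: split_indicator)

lemma borel_measurable_coord:
  "i \<in> I \<Longrightarrow> (\<lambda>x. x i) \<in> borel_measurable (Pi\<^sub>M I (\<lambda>_. lborel :: real measure))"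
  using measurable_component_singleton[of i I "\<lambda>_. lborel :: real measure"] by simp

lemma borel_measurable_sum_coord:
  "(\<lambda>x. \<Sum>i\<in>I. x i) \<in> borel_measurable (Pi\<^sub>M I (\<lambda>_. lborel :: real measure))"
  by (intro borel_measurable_sum borel_measurable_coord)

lemma sets_Delta_chart_domain:
  fixes m :: nat
  shows "{v \<in> {..<m} \<rightarrow>\<^sub>E {..0::real}. - 1 \<le> (\<Sum>j<m. v j)} \<in> sets (Pi\<^sub>M {..<m} (\<lambda>_. lborel))"
proof -
  have "{v \<in> space (Pi\<^sub>M {..<m} (\<lambda>_. lborel :: real measure)). (\<forall>i\<in>{..<m}. v i \<le> 0) \<and> - 1 \<le> (\<Sum>j<m. v j)}
     \<in> sets (Pi\<^sub>M {..<m} (\<lambda>_. lborel))"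
    by (intro sets.sets_Collect_conj sets.sets_Collect_finite_All borel_measurable_le
        borel_measurable_sum_coord borel_measurable_coord) auto
  also have "{v \<in> space (Pi\<^sub>M {..<m} (\<lambda>_. lborel :: real measure)). (\<forall>i\<in>{..<m}. v i \<le> 0) \<and> - 1 \<le> (\<Sum>j<m. v j)}
     = {v \<in> {..<m} \<rightarrow>\<^sub>E {..0::real}. - 1 \<le> (\<Sum>j<m. v j)}"
    by (auto simp: space_PiM PiE_def Pi_def)
  finally show ?thesis .
qed

lemma measurable_Delta_chart:
  "Delta_chart (Suc m) \<in> Pi\<^sub>M {..<m} (\<lambda>_. lborel) \<rightarrow>\<^sub>M Pi\<^sub>M {..<Suc m} (\<lambda>_. lborel)"
  unfolding Delta_chart_def
proof (rule measurable_restrict)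
  fix i assume "i \<in> {..<Suc m}"
  moreover have "(\<lambda>v. - 1 - (\<Sum>j<m. v j)) \<in> borel_measurable (Pi\<^sub>M {..<m} (\<lambda>_. lborel :: real measure))"
    by (intro borel_measurable_diff borel_measurable_const borel_measurable_sum_coord)
  ultimately show "(\<lambda>v. if i = Suc m - 1 then - 1 - (\<Sum>j<Suc m - 1. v j) else v i) \<in> Pi\<^sub>M {..<m} (\<lambda>_. lborel) \<rightarrow>\<^sub>M lborel"
    using borel_measurable_coord[of i "{..<m}"] by (cases "i = m") (simp_all add: less_Suc_eq)
qed

lemma sum_Delta_chart: "(\<Sum>i<Suc m. Delta_chart (Suc m) v i) = - 1"
  by (simp add: Delta_chart_def)

text \<open>Polar coordinates with \<open>c = - (\<Sum>i<Suc m. y i)\<close> as radius. The product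
  of exponentials is \<open>exp (- c)\<close> on the slice of radius \<open>c\<close>; this slice is
  \<open>c\<close> times the simplex, with Jacobian \<open>c ^ m\<close> in the first
  \<open>m\<close> coordinates, and \<open>hom\<close> removes \<open>c\<close> from
  \<open>f\<close>. The integral thus factors into a simplex part and a radial part.\<close>

lemma nn_integral_polar:
  fixes f :: "(nat \<Rightarrow> real) \<Rightarrow> ennreal"
  assumes [measurable]: "f \<in> borel_measurable (Pi\<^sub>M {..<Suc m} (\<lambda>_. lborel))"
    and hom: "\<And>c y. c > 0 \<Longrightarrow> y \<in> {..<Suc m} \<rightarrow>\<^sub>E {..0} \<Longrightarrow> f (\<lambda>i\<in>{..<Suc m}. c * y i) = f y"
  shows "(\<integral>\<^sup>+y. f y * (\<Prod>i<Suc m. ennreal (exp (y i)) * indicator {..0} (y i)) \<partial>Pi\<^sub>M {..<Suc m} (\<lambda>_. lborel)) =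
    (\<integral>\<^sup>+v. f (Delta_chart (Suc m) v) * indicator {v \<in> {..<m} \<rightarrow>\<^sub>E {..0}. - 1 \<le> (\<Sum>j<m. v j)} v \<partial>Pi\<^sub>M {..<m} (\<lambda>_. lborel)) *
    (\<integral>\<^sup>+c. ennreal (exp (- c) * c ^ m) * indicator {0<..} c \<partial>lborel)"
proof -
  interpret product_sigma_finite "\<lambda>_::nat. lborel :: real measure"
    by unfold_locales
  interpret P: sigma_finite_measure "Pi\<^sub>M {..<m} (\<lambda>_. lborel :: real measure)"
    by (rule sigma_finite) simp
  interpret Q: pair_sigma_finite "Pi\<^sub>M {..<m} (\<lambda>_. lborel :: real measure)" "lborel :: real measure"
    by unfold_locales
  define D where "D = {v \<in> {..<m} \<rightarrow>\<^sub>E {..0::real}. - 1 \<le> (\<Sum>j<m. v j)}"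
  have [measurable]: "D \<in> sets (Pi\<^sub>M {..<m} (\<lambda>_. lborel))"
    unfolding D_def by (rule sets_Delta_chart_domain)
  note [measurable] = measurable_Delta_chart
  define G where "G y = f y * (\<Prod>i<Suc m. ennreal (exp (y i)) * indicator {..0} (y i))" for y
  have [measurable]: "G \<in> borel_measurable (Pi\<^sub>M (insert m {..<m}) (\<lambda>_. lborel))"
    unfolding G_def lessThan_Suc[symmetric] by measurable
  have G_eq: "G y = f y * (ennreal (exp (\<Sum>i<Suc m. y i)) * indicator {y. \<forall>i<Suc m. y i \<le> 0} y)" for y
    unfolding G_def by (subst prod_exp_indicator) (auto split: split_indicator)
  have [measurable]: "(\<lambda>w. \<Sum>j<m. w j) \<in> borel_measurable (Pi\<^sub>M {..<m} (\<lambda>_. lborel :: real measure))"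
    by (rule borel_measurable_sum_coord)
  have sl: "(\<Sum>i<Suc m. (w(m := - c - (\<Sum>j<m. w j))) i) = - c" for w :: "nat \<Rightarrow> real" and c
    by simp
  have "(\<integral>\<^sup>+y. G y \<partial>Pi\<^sub>M {..<Suc m} (\<lambda>_. lborel)) = (\<integral>\<^sup>+w. \<integral>\<^sup>+z. G (w(m := z)) \<partial>lborel \<partial>Pi\<^sub>M {..<m} (\<lambda>_. lborel))"
    unfolding lessThan_Suc by (subst product_nn_integral_insert) auto
  \<comment> \<open>With the other coordinates fixed, the last one is exchanged for
    \<open>c\<close>, minus the total sum; the order of integration is then reversed so that each
    \<open>c\<close> yields one slice.\<close>
  also have "\<dots> = (\<integral>\<^sup>+w. \<integral>\<^sup>+c. G (w(m := - c - (\<Sum>j<m. w j))) \<partial>lborel \<partial>Pi\<^sub>M {..<m} (\<lambda>_. lborel))"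
  proof (rule nn_integral_cong)
    fix w assume [measurable]: "w \<in> space (Pi\<^sub>M {..<m} (\<lambda>_. lborel :: real measure))"
    have "(\<lambda>z. G (w(m := z))) \<in> borel_measurable borel" by measurable
    then show "(\<integral>\<^sup>+z. G (w(m := z)) \<partial>lborel) = (\<integral>\<^sup>+c. G (w(m := - c - (\<Sum>j<m. w j))) \<partial>lborel)"
      by (subst nn_integral_real_affine[where c = "-1" and t = "- (\<Sum>j<m. w j)"]) simp_all
  qed
  also have "\<dots> = (\<integral>\<^sup>+c. \<integral>\<^sup>+w. G (w(m := - c - (\<Sum>j<m. w j))) \<partial>Pi\<^sub>M {..<m} (\<lambda>_. lborel) \<partial>lborel)"
    by (rule Q.Fubini'[symmetric]) measurable
  also have "\<dots> = (\<integral>\<^sup>+c. (\<integral>\<^sup>+v. f (Delta_chart (Suc m) v) * indicator D v \<partial>Pi\<^sub>M {..<m} (\<lambda>_. lborel)) *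
       (ennreal (exp (- c) * c ^ m) * indicator {0<..} c) \<partial>lborel)"
  proof (intro nn_integral_cong_AE)
    \<comment> \<open>The point \<open>c = 0\<close> has to be discarded: for \<open>m = 0\<close>
      the inner measure is a point mass, so the left side can be positive there while the right side
      vanishes.\<close>
    show "AE c in lborel. (\<integral>\<^sup>+w. G (w(m := - c - (\<Sum>j<m. w j))) \<partial>Pi\<^sub>M {..<m} (\<lambda>_. lborel)) =
      (\<integral>\<^sup>+v. f (Delta_chart (Suc m) v) * indicator D v \<partial>Pi\<^sub>M {..<m} (\<lambda>_. lborel)) *
       (ennreal (exp (- c) * c ^ m) * indicator {0<..} c)"
      using AE_lborel_singleton[of 0]
    proof eventually_elim
      case (elim c)
      show ?case
      proof (cases "c > 0")
        case False
        with elim have "c < 0" by simp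
        \<comment> \<open>A vector with nonpositive coordinates cannot have the positive sum
          \<open>- c\<close>.\<close>
        have "G (w(m := - c - (\<Sum>j<m. w j))) = 0" for w
        proof -
          have "\<not> (\<forall>i<Suc m. (w(m := - c - (\<Sum>j<m. w j))) i \<le> 0)"
          proof
            assume "\<forall>i<Suc m. (w(m := - c - (\<Sum>j<m. w j))) i \<le> 0"
            then have "(\<Sum>i<Suc m. (w(m := - c - (\<Sum>j<m. w j))) i) \<le> 0"
              by (intro sum_nonpos) (simp only: lessThan_iff)
            then show False using \<open>c < 0\<close> unfolding sl by simp
          qed
          then show ?thesis by (simp add: G_eq)
        qed
        with False show ?thesis by simp
      next
        case True
        \<comment> \<open>Scaling the \<open>m\<close> free coordinates by \<open>c\<close> carries
          the slice of radius \<open>1\<close> to that of radius \<open>c\<close>; the last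
          coordinate follows, as \<open>- c - c * s = c * (- 1 - s)\<close>.\<close>
        have "(\<integral>\<^sup>+w. G (w(m := - c - (\<Sum>j<m. w j))) \<partial>Pi\<^sub>M {..<m} (\<lambda>_. lborel)) =
          (\<integral>\<^sup>+v. G ((\<lambda>i\<in>{..<m}. c * v i)(m := - c - (\<Sum>j<m. (\<lambda>i\<in>{..<m}. c * v i) j))) \<partial>Pi\<^sub>M {..<m} (\<lambda>_. lborel)) *
           ennreal (c ^ card {..<m})"
          using True by (intro nn_integral_PiM_scale) auto
        also have "(\<integral>\<^sup>+v. G ((\<lambda>i\<in>{..<m}. c * v i)(m := - c - (\<Sum>j<m. (\<lambda>i\<in>{..<m}. c * v i) j))) \<partial>Pi\<^sub>M {..<m} (\<lambda>_. lborel)) =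
          (\<integral>\<^sup>+v. f (Delta_chart (Suc m) v) * indicator D v * ennreal (exp (- c)) \<partial>Pi\<^sub>M {..<m} (\<lambda>_. lborel))"
        proof (intro nn_integral_cong)
          fix v assume "v \<in> space (Pi\<^sub>M {..<m} (\<lambda>_. lborel :: real measure))"
          then have v: "v \<in> extensional {..<m}" by (auto simp: space_PiM PiE_def)
          let ?y = "(\<lambda>i\<in>{..<m}. c * v i)(m := - c - (\<Sum>j<m. (\<lambda>i\<in>{..<m}. c * v i) j))"
          have y: "?y = (\<lambda>i\<in>{..<Suc m}. c * Delta_chart (Suc m) v i)"
            by (auto simp: fun_eq_iff Delta_chart_def sum_distrib_left algebra_simps)
          have "(\<forall>i<Suc m. ?y i \<le> 0) \<longleftrightarrow> (\<forall>i<Suc m. Delta_chart (Suc m) v i \<le> 0)"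
            unfolding y using True by (auto simp: mult_le_0_iff)
          also have iff2: "\<dots> \<longleftrightarrow> v \<in> D"
            using v by (auto simp: Delta_chart_def D_def less_Suc_eq PiE_def Pi_def)
          finally have iff: "(\<forall>i<Suc m. ?y i \<le> 0) \<longleftrightarrow> v \<in> D" .
          show "G ?y = f (Delta_chart (Suc m) v) * indicator D v * ennreal (exp (- c))"
          proof (cases "v \<in> D")
            case True
            have "Delta_chart (Suc m) v \<in> {..<Suc m} \<rightarrow>\<^sub>E {..0}"
              using True iff2 by (auto simp: Delta_chart_def PiE_def)
            then have "f ?y = f (Delta_chart (Suc m) v)"
              unfolding y by (rule hom[OF \<open>c > 0\<close>])
            moreover have "indicator {y. \<forall>i<Suc m. y i \<le> 0} ?y = (1 :: ennreal)"
              using iff True by (simp only: indicator_simps mem_Collect_eq)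
            ultimately show ?thesis
              using True unfolding G_eq sl by (simp only: indicator_simps mult_1_left mult_1_right)
          next
            case False
            then have "indicator {y. \<forall>i<Suc m. y i \<le> 0} ?y = (0 :: ennreal)"
              using iff by (simp only: indicator_simps mem_Collect_eq simp_thms)
            with False show ?thesis unfolding G_eq by (simp only: indicator_simps mult_zero_right mult_zero_left simp_thms)
          qed
        qed
        also have "\<dots> = (\<integral>\<^sup>+v. f (Delta_chart (Suc m) v) * indicator D v \<partial>Pi\<^sub>M {..<m} (\<lambda>_. lborel)) * ennreal (exp (- c))"
          by (rule nn_integral_multc) measurable
        finally show ?thesis
          using True by (simp add: ennreal_mult mult.assoc del: fun_upd_apply)
      qed
    qed
  qed
  also have "\<dots> = (\<integral>\<^sup>+v. f (Delta_chart (Suc m) v) * indicator D v \<partial>Pi\<^sub>M {..<m} (\<lambda>_. lborel)) *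
    (\<integral>\<^sup>+c. ennreal (exp (- c) * c ^ m) * indicator {0<..} c \<partial>lborel)"
    by (rule nn_integral_cmult) measurable
  finally show ?thesis
    unfolding G_def D_def .
qed

section \<open>The free algebra and the filters of points\<close>

lemma Free_simps:
  "a \<otimes>\<^bsub>Free n\<^esub> b = (\<lambda>p\<in>cube n. a p * b p)"
  "a \<leadsto>\<^bsub>Free n\<^esub> b = (\<lambda>p\<in>cube n. min 1 (b p / a p))"
  "\<one>\<^bsub>Free n\<^esub> = (\<lambda>p\<in>cube n. 1)"
  by (simp_all add: Free_def fun_alg_def M_alg_def)

lemma Free_proj: "i < n \<Longrightarrow> proj n i \<in> carrier (Free n)"
  by (auto simp: Free_def intro: gen_carrier.gen)

lemma Free_one: "(\<lambda>p\<in>cube n. 1) \<in> carrier (Free n)"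
  using gen_carrier.one[of "fun_alg (cube n) M_alg"] by (simp add: Free_def fun_alg_def M_alg_def)

lemma Free_mult:
  "a \<in> carrier (Free n) \<Longrightarrow> b \<in> carrier (Free n) \<Longrightarrow> (\<lambda>p\<in>cube n. a p * b p) \<in> carrier (Free n)"
  using gen_carrier.mult[of a "fun_alg (cube n) M_alg" _ b] by (simp add: Free_def fun_alg_def M_alg_def)

lemma Free_imp:
  "a \<in> carrier (Free n) \<Longrightarrow> b \<in> carrier (Free n) \<Longrightarrow> (\<lambda>p\<in>cube n. min 1 (b p / a p)) \<in> carrier (Free n)"
  using gen_carrier.imp[of a "fun_alg (cube n) M_alg" _ b] by (simp add: Free_def fun_alg_def M_alg_def)

lemma Free_induct [consumes 1, case_names proj one mult imp]:
  assumes "t \<in> carrier (Free n)"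
    and "\<And>i. i < n \<Longrightarrow> P (proj n i)"
    and "P (\<lambda>p\<in>cube n. 1)"
    and "\<And>a b. a \<in> carrier (Free n) \<Longrightarrow> b \<in> carrier (Free n) \<Longrightarrow> P a \<Longrightarrow> P b \<Longrightarrow> P (\<lambda>p\<in>cube n. a p * b p)"
    and "\<And>a b. a \<in> carrier (Free n) \<Longrightarrow> b \<in> carrier (Free n) \<Longrightarrow> P a \<Longrightarrow> P b \<Longrightarrow> P (\<lambda>p\<in>cube n. min 1 (b p / a p))"
  shows "P t"
proof -
  have carrier: "carrier (Free n) = gen_carrier (fun_alg (cube n) M_alg) (proj n ` {..<n})"
    by (simp add: Free_def)
  have "t \<in> gen_carrier (fun_alg (cube n) M_alg) (proj n ` {..<n})"
    using assms(1) by (simp only: carrier)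
  then show ?thesis
  proof induction
    case (gen a)
    then show ?case using assms(2) by auto
  next
    case one
    have "\<one>\<^bsub>fun_alg (cube n) M_alg\<^esub> = (\<lambda>p\<in>cube n. 1)" by (simp add: fun_alg_def M_alg_def)
    then show ?case using assms(3) by (simp only:)
  next
    case (mult a b)
    have "a \<otimes>\<^bsub>fun_alg (cube n) M_alg\<^esub> b = (\<lambda>p\<in>cube n. a p * b p)" by (simp add: fun_alg_def M_alg_def)
    then show ?case using assms(4)[of a b] mult unfolding carrier by (simp only:)
  next
    case (imp a b)
    have "a \<leadsto>\<^bsub>fun_alg (cube n) M_alg\<^esub> b = (\<lambda>p\<in>cube n. min 1 (b p / a p))" by (simp add: fun_alg_def M_alg_def)
    then show ?case using assms(5)[of a b] imp unfolding carrier by (simp only:)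
  qed
qed

lemma cube_mem: "p \<in> cube n \<Longrightarrow> i < n \<Longrightarrow> 0 < p i \<and> p i \<le> 1"
  by (simp add: cube_def PiE_iff)

lemma cubeI: "p \<in> extensional {..<n} \<Longrightarrow> (\<And>i. i < n \<Longrightarrow> 0 < p i \<and> p i \<le> 1) \<Longrightarrow> p \<in> cube n"
  by (simp add: cube_def PiE_iff)

lemma proj_apply: "p \<in> cube n \<Longrightarrow> proj n i p = p i"
  by (simp add: proj_def)

lemma Free_range:
  assumes "t \<in> carrier (Free n)" "p \<in> cube n"
  shows "t p \<in> {0<..1}"
  using assms(1)
proof (induction rule: Free_induct)
  case (proj i)
  then show ?case using assms(2) by (simp add: proj_def cube_mem)
next
  case one
  show ?case using assms(2) by simp
next
  case (mult a b)
  then show ?case using assms(2) by (simp add: mult_le_one)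
next
  case (imp a b)
  then show ?case using assms(2) by simp
qed

instance hterm :: countable
  by countable_datatype

text \<open>Every element is the value of a term in the projections, and there are countably many
  terms. An inclusion suffices, so it does no harm that variables of index at least \<open>n\<close>
  need not evaluate into the carrier.\<close>

lemma countable_Free: "countable (carrier (Free n))"
proof -
  have "carrier (Free n) \<subseteq> range (heval (Free n) (proj n))"
  proof
    fix t assume "t \<in> carrier (Free n)"
    then show "t \<in> range (heval (Free n) (proj n))"
    proof (induction rule: Free_induct)
      case (proj i)
      then show ?case by (intro range_eqI[of _ _ "HVar i"]) simp
    next
      case one
      then show ?case by (intro range_eqI[of _ _ HOne]) (simp add: Free_simps)
    next
      case (mult a b)
      then obtain s r where "a = heval (Free n) (proj n) s" "b = heval (Free n) (proj n) r" by auto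
      then show ?case by (intro range_eqI[of _ _ "HMult s r"]) (simp add: Free_simps)
    next
      case (imp a b)
      then obtain s r where "a = heval (Free n) (proj n) s" "b = heval (Free n) (proj n) r" by auto
      then show ?case by (intro range_eqI[of _ _ "HImp s r"]) (simp add: Free_simps)
    qed
  qed
  then show ?thesis by (rule countable_subset) simp
qed

text \<open>Both sides depend homomorphically on \<open>t\<close> and agree on the generators:
  \<open>\<sigma>\<close> acts as composition with a map of the cube into itself.\<close>

lemma endo_eval:
  assumes \<sigma>: "\<sigma> \<in> hoop_hom (Free n) (Free n)" and t: "t \<in> carrier (Free n)" and p: "p \<in> cube n"
  shows "\<sigma> t p = t (\<lambda>i\<in>{..<n}. \<sigma> (proj n i) p)"
proof -
  define q where "q = (\<lambda>i\<in>{..<n}. \<sigma> (proj n i) p)"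
  have hom: "\<sigma> a \<in> carrier (Free n)" "\<sigma> (a \<otimes>\<^bsub>Free n\<^esub> b) = \<sigma> a \<otimes>\<^bsub>Free n\<^esub> \<sigma> b"
      "\<sigma> (a \<leadsto>\<^bsub>Free n\<^esub> b) = \<sigma> a \<leadsto>\<^bsub>Free n\<^esub> \<sigma> b" "\<sigma> \<one>\<^bsub>Free n\<^esub> = \<one>\<^bsub>Free n\<^esub>"
    if "a \<in> carrier (Free n)" "b \<in> carrier (Free n)" for a b
    using \<sigma> that by (auto simp: hoop_hom_def)
  have q: "q \<in> cube n"
    using Free_range[OF hom(1)[OF Free_proj Free_one] p] by (intro cubeI) (simp_all add: q_def)
  have q_eq: "q i = \<sigma> (proj n i) p" if "i < n" for i
    using that by (simp add: q_def)
  have "\<sigma> t p = t q"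
    using t
  proof (induction rule: Free_induct)
    case (proj i)
    then show ?case using proj_apply[OF q] q_eq by simp
  next
    case one
    then show ?case using hom(4)[OF Free_one Free_one] p q by (simp add: Free_simps restrict_def)
  next
    case (mult a b)
    then show ?case using hom(2)[of a b] p q by (simp add: Free_simps restrict_def)
  next
    case (imp a b)
    then show ?case using hom(3)[of a b] p q by (simp add: Free_simps restrict_def)
  qed
  then show ?thesis by (simp only: q_def)
qed

section \<open>Logarithmic coordinates, homogeneity and measurability\<close>

lemma exp_vec_in_cube: "u \<in> {..<n} \<rightarrow>\<^sub>E {..0} \<Longrightarrow> exp_vec n u \<in> cube n"
  by (intro cubeI) (simp_all add: exp_vec_def PiE_iff)

text \<open>For \<open>c > 0\<close> the map \<open>x powr c\<close> respects products and quotients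
  and, being monotone with value \<open>1\<close> at \<open>1\<close>, also truncation at
  \<open>1\<close>. So it is an endomorphism of \<open>M_alg\<close>, and scaling \<open>u\<close>
  by \<open>c\<close> applies it to every coordinate.\<close>

lemma Free_exp_scale:
  assumes "t \<in> carrier (Free n)" "u \<in> {..<n} \<rightarrow>\<^sub>E {..0}" "c > 0"
  shows "t (exp_vec n (\<lambda>i\<in>{..<n}. c * u i)) = t (exp_vec n u) powr c"
proof -
  define w where "w = (\<lambda>i\<in>{..<n}. c * u i)"
  have w: "w \<in> {..<n} \<rightarrow>\<^sub>E {..0}"
    unfolding w_def using assms(2,3) by (simp add: mult_le_0_iff PiE_iff)
  have w_eq: "w i = c * u i" if "i < n" for i
    using that by (simp add: w_def)
  note p = exp_vec_in_cube[OF w] exp_vec_in_cube[OF assms(2)]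
  have "t (exp_vec n w) = t (exp_vec n u) powr c"
    using assms(1)
  proof (induction rule: Free_induct)
    case (proj i)
    then show ?case unfolding p[THEN proj_apply] by (simp add: exp_vec_def w_eq powr_def mult.commute)
  next
    case one
    then show ?case using p by simp
  next
    case (mult a b)
    then show ?case using p Free_range[OF _ p(2), of a] Free_range[OF _ p(2), of b]
      by (simp add: powr_mult)
  next
    case (imp a b)
    have pos: "a (exp_vec n u) > 0" "b (exp_vec n u) > 0"
      using imp Free_range[OF _ p(2)] by auto
    let ?r = "b (exp_vec n u) / a (exp_vec n u)"
    have "min 1 (?r powr c) = (min 1 ?r) powr c"
    proof (cases "?r \<le> 1")
      case True
      then have "?r powr c \<le> 1" using assms(3) pos by (intro powr_le1) auto
      then show ?thesis using True by (simp add: min_def)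
    next
      case False
      then have "?r powr c \<ge> 1" using assms(3) by (intro ge_one_powr_ge_zero) auto
      then show ?thesis using False by (simp add: min_def)
    qed
    then show ?case using p imp pos by (simp add: powr_divide)
  qed
  then show ?thesis by (simp only: w_def)
qed

lemma rho_scale:
  assumes "u \<in> {..<n} \<rightarrow>\<^sub>E {..0}" "c > 0"
  shows "rho n (\<lambda>i\<in>{..<n}. c * u i) = rho n u"
proof -
  have "t (exp_vec n u) powr c = 1 \<longleftrightarrow> t (exp_vec n u) = 1" if "t \<in> carrier (Free n)" for t
    using Free_range[OF that exp_vec_in_cube[OF assms(1)]] assms(2)
    by (auto simp: powr_def)
  then show ?thesis
    unfolding rho_def by (intro Collect_cong conj_cong refl) (simp only: Free_exp_scale[OF _ assms])
qed

lemma sets_cube: "cube n \<in> sets (Pi\<^sub>M {..<n} (\<lambda>_. lborel))"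
  unfolding cube_def by (intro sets_PiM_I_finite) auto

lemma borel_measurable_Free:
  assumes "t \<in> carrier (Free n)"
  shows "t \<in> borel_measurable (Pi\<^sub>M {..<n} (\<lambda>_. lborel))"
proof -
  \<comment> \<open>Off the cube every element is constantly \<open>undefined\<close>, so
    measurability follows by cases on membership in this Borel set.\<close>
  note [measurable] = sets_cube[of n]
  show ?thesis
    using assms
  proof (induction rule: Free_induct)
    case (proj i)
    then have [measurable]: "(\<lambda>p. p i) \<in> borel_measurable (Pi\<^sub>M {..<n} (\<lambda>_. lborel :: real measure))"
      by (intro borel_measurable_coord) simp
    show ?case unfolding proj_def restrict_def by measurable
  next
    case one
    show ?case unfolding restrict_def by measurable
  next
    case (mult a b)
    note [measurable] = mult
    show ?case unfolding restrict_def by measurable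
  next
    case (imp a b)
    note [measurable] = imp
    show ?case unfolding restrict_def by measurable
  qed
qed

section \<open>Prime filters given by points, and their pullback along
  \<open>\<sigma>\<close>\<close>

lemma heval_transport:
  assumes carrier: "carrier B = emb ` carrier A"
    and un: "\<And>x. x \<in> carrier A \<Longrightarrow> un (emb x) = x"
    and ops: "\<one>\<^bsub>B\<^esub> = emb \<one>\<^bsub>A\<^esub>" "\<And>X Y. X \<otimes>\<^bsub>B\<^esub> Y = emb (un X \<otimes>\<^bsub>A\<^esub> un Y)"
      "\<And>X Y. X \<leadsto>\<^bsub>B\<^esub> Y = emb (un X \<leadsto>\<^bsub>A\<^esub> un Y)"
    and A: "is_algebra A" and e: "range e \<subseteq> carrier B"
  shows "heval A (un \<circ> e) s \<in> carrier A \<and> heval B e s = emb (heval A (un \<circ> e) s)"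
proof (induction s)
  case (HVar i)
  have "e i \<in> emb ` carrier A" using e carrier by auto
  then show ?case using un by auto
qed (use A un in \<open>auto simp: ops is_algebra_def\<close>)

text \<open>Codomains in \<open>hoop_filter\<close> must live on a prescribed type. This lemma moves
  an algebra to a copy on another type: evaluation of terms commutes with \<open>emb\<close>, so all
  identities persist.\<close>

lemma in_variety_transport:
  assumes carrier: "carrier B = emb ` carrier A"
    and un: "\<And>x. x \<in> carrier A \<Longrightarrow> un (emb x) = x"
    and ops: "\<one>\<^bsub>B\<^esub> = emb \<one>\<^bsub>A\<^esub>" "\<And>X Y. X \<otimes>\<^bsub>B\<^esub> Y = emb (un X \<otimes>\<^bsub>A\<^esub> un Y)"
      "\<And>X Y. X \<leadsto>\<^bsub>B\<^esub> Y = emb (un X \<leadsto>\<^bsub>A\<^esub> un Y)"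
    and A: "in_variety A"
  shows "in_variety B"
  unfolding in_variety_def
proof (intro conjI allI impI)
  have alg: "is_algebra A" using A by (simp add: in_variety_def)
  then show "is_algebra B"
    using un by (auto simp: is_algebra_def carrier ops)
  fix s t assume "satisfies M_alg s t"
  then have st: "satisfies A s t" using A by (simp add: in_variety_def)
  show "satisfies B s t"
    unfolding satisfies_def
  proof (intro allI impI)
    fix e :: "nat \<Rightarrow> _" assume e: "range e \<subseteq> carrier B"
    then have "range (un \<circ> e) \<subseteq> carrier A" using un carrier by auto
    with st have "heval A (un \<circ> e) s = heval A (un \<circ> e) t" by (simp add: satisfies_def)
    then show "heval B e s = heval B e t"
      using heval_transport[OF carrier un ops alg e] by simp
  qed
qed

lemma in_variety_M_alg: "in_variety M_alg"
  by (auto simp: in_variety_def is_algebra_def M_alg_def intro: mult_le_one)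

text \<open>Evaluation at \<open>p\<close> is a homomorphism into \<open>M_alg\<close>, and
  primeness holds because the join there is the maximum of two reals.\<close>

lemma prime_filter_point:
  assumes p: "p \<in> cube n"
  shows "prime_filter (Free n) {t \<in> carrier (Free n). t p = 1}"
proof -
  \<comment> \<open>A real \<open>x\<close> is coded by the singleton of the constant function
    \<open>x\<close>, which has the type demanded by \<open>hoop_filter\<close>; \<open>un\<close>
    decodes by evaluating at an arbitrary point.\<close>
  define emb :: "real \<Rightarrow> ((nat \<Rightarrow> real) \<Rightarrow> real) set" where "emb x = {\<lambda>_. x}" for x
  define un :: "((nat \<Rightarrow> real) \<Rightarrow> real) set \<Rightarrow> real" where "un X = the_elem X undefined" for X
  have un: "un (emb x) = x" for x by (simp add: un_def emb_def)
  define B :: "((nat \<Rightarrow> real) \<Rightarrow> real) set hoop" where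
    "B = \<lparr>carrier = emb ` carrier M_alg, mult = (\<lambda>X Y. emb (un X \<otimes>\<^bsub>M_alg\<^esub> un Y)),
      one = emb \<one>\<^bsub>M_alg\<^esub>, imp = (\<lambda>X Y. emb (un X \<leadsto>\<^bsub>M_alg\<^esub> un Y))\<rparr>"
  have "in_variety B"
    by (rule in_variety_transport[where un = un and emb = emb, OF _ _ _ _ _ in_variety_M_alg])
      (simp_all add: B_def un)
  moreover have "(\<lambda>t. emb (t p)) \<in> hoop_hom (Free n) B"
    using Free_range[OF _ p] p by (auto simp: hoop_hom_def B_def Free_simps un M_alg_def)
  moreover have "{t \<in> carrier (Free n). t p = 1} = {t \<in> carrier (Free n). emb (t p) = \<one>\<^bsub>B\<^esub>}"
    by (auto simp: B_def emb_def M_alg_def dest: fun_cong)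
  ultimately have "hoop_filter (Free n) {t \<in> carrier (Free n). t p = 1}"
    unfolding hoop_filter_def by blast
  moreover have "a p = 1 \<or> b p = 1"
    if "a \<in> carrier (Free n)" "b \<in> carrier (Free n)" "hjoin (Free n) a b p = 1" for a b
    using that Free_range[OF _ p, of a] Free_range[OF _ p, of b] p
    by (auto simp: hjoin_def Free_simps min_def divide_simps split: if_splits)
  ultimately show ?thesis
    by (auto simp: prime_filter_def)
qed

lemma point_in_Spec:
  assumes "p \<in> cube n" "i < n" "p i \<noteq> 1"
  shows "{t \<in> carrier (Free n). t p = 1} \<in> Spec n"
proof -
  have "proj n i \<notin> {t \<in> carrier (Free n). t p = 1}" using assms by (simp add: proj_apply)
  with Free_proj[OF assms(2)] have "{t \<in> carrier (Free n). t p = 1} \<noteq> carrier (Free n)" by blast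
  then show ?thesis using prime_filter_point[OF assms(1)] by (simp add: Spec_def)
qed

lemma hoop_filter_vimage:
  assumes "\<sigma> \<in> hoop_hom A A" "hoop_filter A F"
  shows "hoop_filter A {t \<in> carrier A. \<sigma> t \<in> F}"
proof -
  obtain B :: "'a set hoop" and h where "in_variety B" "h \<in> hoop_hom A B" "F = {a \<in> carrier A. h a = \<one>\<^bsub>B\<^esub>}"
    using assms(2) by (auto simp: hoop_filter_def)
  moreover from this have "h \<circ> \<sigma> \<in> hoop_hom A B"
    using assms(1) by (auto simp: hoop_hom_def Pi_def)
  moreover have "{t \<in> carrier A. \<sigma> t \<in> F} = {t \<in> carrier A. (h \<circ> \<sigma>) t = \<one>\<^bsub>B\<^esub>}"
    using assms(1) \<open>F = _\<close> by (auto simp: hoop_hom_def Pi_def)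
  ultimately show ?thesis unfolding hoop_filter_def by blast
qed

text \<open>Filters pull back by composing homomorphisms, and primeness survives because
  \<open>\<sigma>\<close> preserves joins; properness is what nontriviality asserts.\<close>

lemma S_map_in_Spec:
  assumes "nontrivial_endo n \<sigma>" "P \<in> Spec n"
  shows "S_map n \<sigma> P \<in> Spec n"
proof -
  have \<sigma>: "\<sigma> \<in> hoop_hom (Free n) (Free n)" "S_map n \<sigma> P \<noteq> carrier (Free n)"
    using assms by (auto simp: nontrivial_endo_def)
  have "hoop_filter (Free n) (S_map n \<sigma> P)"
    unfolding S_map_def using assms(2)
    by (intro hoop_filter_vimage \<sigma>) (auto simp: Spec_def prime_filter_def)
  moreover have "a \<in> S_map n \<sigma> P \<or> b \<in> S_map n \<sigma> P"
    if ab: "a \<in> carrier (Free n)" "b \<in> carrier (Free n)" "hjoin (Free n) a b \<in> S_map n \<sigma> P" for a b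
  proof -
    have imp: "a \<leadsto>\<^bsub>Free n\<^esub> b \<in> carrier (Free n)" using ab by (simp add: Free_simps Free_imp)
    have "\<sigma> (hjoin (Free n) a b) = hjoin (Free n) (\<sigma> a) (\<sigma> b)"
      using \<sigma>(1) ab imp by (simp add: hoop_hom_def hjoin_def)
    then have "hjoin (Free n) (\<sigma> a) (\<sigma> b) \<in> P" using ab by (simp add: S_map_def)
    moreover have "\<sigma> a \<in> carrier (Free n)" "\<sigma> b \<in> carrier (Free n)"
      using \<sigma>(1) ab by (auto simp: hoop_hom_def)
    ultimately show ?thesis using assms(2) ab by (auto simp: Spec_def prime_filter_def S_map_def)
  qed
  ultimately show ?thesis using \<sigma>(2) by (auto simp: Spec_def prime_filter_def)
qed

section \<open>The conjugacy relation on the simplex\<close>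

lemma Delta_nonpos: "u \<in> Delta n \<Longrightarrow> u \<in> {..<n} \<rightarrow>\<^sub>E {..0}"
  by (simp add: Delta_def)

lemma rho_in_Spec:
  assumes "u \<in> {..<n} \<rightarrow>\<^sub>E {..0}" "i < n" "u i \<noteq> 0"
  shows "rho n u \<in> Spec n"
  unfolding rho_def using assms
  by (intro point_in_Spec[of _ _ i] exp_vec_in_cube) (simp_all add: exp_vec_def)

lemma rho_Delta_in_Spec:
  assumes "u \<in> Delta n"
  shows "rho n u \<in> Spec n"
proof -
  have "(\<Sum>i<n. u i) \<noteq> 0" using assms by (simp add: Delta_def)
  then obtain i where "i < n" "u i \<noteq> 0" by (meson lessThan_iff sum.neutral)
  then show ?thesis using Delta_nonpos[OF assms] by (intro rho_in_Spec)
qed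

text \<open>In logarithmic coordinates the dual map of \<open>\<sigma>\<close> sends
  \<open>u\<close> to \<open>s\<close>, so \<open>endo_eval\<close> yields
  \<open>S_map n \<sigma> (rho n u) = rho n s\<close>. The ray through \<open>s\<close> meets the
  simplex in \<open>s_tilde n \<sigma> u\<close>, and \<open>rho n\<close> is constant along
  rays.\<close>

lemma S_map_rho:
  assumes \<sigma>: "nontrivial_endo n \<sigma>" and u: "u \<in> Delta n"
  shows "s_tilde n \<sigma> u \<in> Delta n" "S_map n \<sigma> (rho n u) = rho n (s_tilde n \<sigma> u)"
proof -
  define s where "s = (\<lambda>i\<in>{..<n}. s_map n \<sigma> i u)"
  have hom: "\<sigma> \<in> hoop_hom (Free n) (Free n)" using \<sigma> by (simp add: nontrivial_endo_def)
  have p: "exp_vec n u \<in> cube n" using u by (intro exp_vec_in_cube Delta_nonpos)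
  have rng: "\<sigma> (proj n i) (exp_vec n u) \<in> {0<..1}" if "i < n" for i
    using hom Free_proj[OF that] p by (intro Free_range) (auto simp: hoop_hom_def)
  then have s: "s \<in> {..<n} \<rightarrow>\<^sub>E {..0}"
    by (simp add: s_def s_map_def PiE_iff)
  have exp_s: "exp_vec n s = (\<lambda>i\<in>{..<n}. \<sigma> (proj n i) (exp_vec n u))"
    using rng by (auto simp: exp_vec_def s_def s_map_def fun_eq_iff)
  have "\<sigma> t \<in> carrier (Free n) \<and> \<sigma> t (exp_vec n u) = t (exp_vec n s)" if "t \<in> carrier (Free n)" for t
    using endo_eval[OF hom that p] hom that unfolding exp_s by (auto simp: hoop_hom_def)
  then have S: "S_map n \<sigma> (rho n u) = rho n s"
    by (auto simp: S_map_def rho_def)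
  have "rho n s \<noteq> carrier (Free n)"
    using \<sigma> rho_Delta_in_Spec[OF u] by (auto simp: nontrivial_endo_def S[symmetric])
  \<comment> \<open>If \<open>s\<close> were zero, \<open>exp_vec n s\<close> would be the point
    with all coordinates \<open>1\<close>, where every element has value \<open>1\<close>; the
    pulled-back filter would be improper, against nontriviality.\<close>
  then have "\<exists>i<n. s i \<noteq> 0"
  proof (rule contrapos_np)
    assume "\<not> (\<exists>i<n. s i \<noteq> 0)"
    then have z: "exp_vec n s i = 1" if "i < n" for i using that by (simp add: exp_vec_def)
    have "t (exp_vec n s) = 1" if "t \<in> carrier (Free n)" for t
      using that
    proof (induction rule: Free_induct)
      case (proj i)
      then show ?case using proj_apply[OF exp_vec_in_cube[OF s]] by (simp add: z)
    qed (use exp_vec_in_cube[OF s] in simp_all)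
    then show "rho n s = carrier (Free n)" by (auto simp: rho_def)
  qed
  moreover have "s i \<le> 0" if "i < n" for i using s that by (simp add: PiE_iff)
  ultimately have "(\<Sum>i<n. s i) < (\<Sum>i<n. 0)"
    by (intro sum_strict_mono_ex1) (auto simp: less_le)
  then have neg: "(\<Sum>i<n. s i) < 0" by simp
  \<comment> \<open>The factor that normalizes the coordinate sum of \<open>s\<close> to
    \<open>- 1\<close>.\<close>
  define c where "c = - inverse (\<Sum>i<n. s i)"
  have "c > 0" using neg by (simp add: c_def)
  have st: "s_tilde n \<sigma> u = (\<lambda>i\<in>{..<n}. c * s i)"
    by (auto simp: s_tilde_def c_def s_def fun_eq_iff)
  show "S_map n \<sigma> (rho n u) = rho n (s_tilde n \<sigma> u)"
    using rho_scale[OF s \<open>c > 0\<close>] by (simp add: S st)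
  have "(\<Sum>i<n. c * s i) = - 1"
    unfolding sum_distrib_left[symmetric] c_def using neg by simp
  then show "s_tilde n \<sigma> u \<in> Delta n"
    using s \<open>c > 0\<close> by (simp add: st Delta_def mult_le_0_iff PiE_iff)
qed

section \<open>Borel structure of the spectrum\<close>

lemma Spec_open_subset: "openin (Spec_top n) U \<Longrightarrow> U \<subseteq> Spec n"
  using openin_subset[of "Spec_top n" U]
  by (auto simp: Spec_top_def topology_generated_by_topspace)

lemma space_Spec_borel: "space (Spec_borel n) = Spec n"
  unfolding Spec_borel_def using Spec_open_subset by (intro space_measure_of) auto

lemma sets_Spec_borel: "sets (Spec_borel n) = sigma_sets (Spec n) {U. openin (Spec_top n) U}"
  unfolding Spec_borel_def using Spec_open_subset by (intro sets_measure_of) auto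

lemma sets_Spec_basic:
  assumes "a \<in> carrier (Free n)"
  shows "{P \<in> Spec n. a \<notin> P} \<in> sets (Spec_borel n)"
  unfolding sets_Spec_borel Spec_top_def using assms
  by (intro sigma_sets.Basic) (auto intro: topology_generated_by_Basis)

lemma pred_mem_Spec:
  assumes "a \<in> carrier (Free n)"
  shows "Measurable.pred (Spec_borel n) (\<lambda>P. a \<in> P)"
proof -
  have "space (Spec_borel n) - {P \<in> Spec n. a \<notin> P} \<in> sets (Spec_borel n)"
    by (intro sets.compl_sets sets_Spec_basic assms)
  also have "space (Spec_borel n) - {P \<in> Spec n. a \<notin> P} = {P \<in> space (Spec_borel n). a \<in> P}"
    by (auto simp: space_Spec_borel)
  finally show ?thesis by (simp add: pred_def)
qed

text \<open>Since \<open>Free n\<close> is countable, so is the base generated by the subbasis.\<close>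

lemma measurable_Spec_borelI:
  assumes f: "f \<in> space M \<rightarrow> Spec n"
    and basic: "\<And>a. a \<in> carrier (Free n) \<Longrightarrow> {x \<in> space M. a \<notin> f x} \<in> sets M"
  shows "f \<in> M \<rightarrow>\<^sub>M Spec_borel n"
  unfolding Spec_borel_def
proof (rule measurable_measure_of[OF _ f])
  show "{U. openin (Spec_top n) U} \<subseteq> Pow (Spec n)" using Spec_open_subset by auto
  fix U assume "U \<in> {U. openin (Spec_top n) U}"
  define S where "S = (\<lambda>a. {P \<in> Spec n. a \<notin> P}) ` carrier (Free n)"
  have "generate_topology_on S U"
    using \<open>U \<in> _\<close> openin_topology_generated_by by (auto simp: Spec_top_def S_def)
  then obtain \<U> where \<U>: "\<U> \<subseteq> {V. (finite' intersection_of (\<lambda>x. x \<in> S)) V}" "U = \<Union>\<U>"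
    unfolding generate_topology_on_eq union_of_def by auto
  have "\<U> \<subseteq> Inter ` {F. finite F \<and> F \<subseteq> S}"
    using \<U>(1) by (auto simp: intersection_of_def)
  moreover have "countable S" unfolding S_def by (intro countable_image countable_Free)
  ultimately have count: "countable \<U>"
    by (rule countable_subset[OF _ countable_image[OF countable_Collect_finite_subset]])
  have S: "f -` X \<inter> space M \<in> sets M" if X: "X \<in> S" for X
  proof -
    obtain a where a: "a \<in> carrier (Free n)" "X = {P \<in> Spec n. a \<notin> P}" using X by (auto simp: S_def)
    have "f -` X \<inter> space M = {x \<in> space M. a \<notin> f x}" using f by (auto simp: a)
    then show ?thesis using basic[OF a(1)] by simp
  qed
  have "f -` V \<inter> space M \<in> sets M" if V: "V \<in> \<U>" for V
  proof -
    obtain F where F: "finite F" "F \<noteq> {}" "F \<subseteq> S" "V = \<Inter>F"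
      using \<U>(1) V by (auto simp: intersection_of_def)
    have "f -` V \<inter> space M = (\<Inter>X\<in>F. f -` X \<inter> space M)" using F by auto
    also have "\<dots> \<in> sets M" using F S by (intro sets.finite_INT) auto
    finally show ?thesis .
  qed
  then have "(\<Union>V\<in>\<U>. f -` V \<inter> space M) \<in> sets M" using count by (intro sets.countable_UN'') auto
  also have "(\<Union>V\<in>\<U>. f -` V \<inter> space M) = f -` U \<inter> space M" using \<U>(2) by auto
  finally show "f -` U \<inter> space M \<in> sets M" .
qed

section \<open>Measurability of the maps on the simplex and on the spectrum\<close>

lemma sets_PiM_lborel: "sets (Pi\<^sub>M I (\<lambda>_. lborel :: real measure)) = sets (Pi\<^sub>M I (\<lambda>_. borel))"
  by (intro sets_PiM_cong) auto

lemma space_PiM_real: "space (Pi\<^sub>M I (\<lambda>_. borel :: real measure)) = extensional I"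
  by (simp add: space_PiM PiE_def)

lemma sets_Delta: "Delta n \<in> sets (Pi\<^sub>M {..<n} (\<lambda>_. borel))"
proof -
  have "{v \<in> space (Pi\<^sub>M {..<n} (\<lambda>_. lborel :: real measure)). (\<forall>i\<in>{..<n}. v i \<le> 0) \<and> (\<Sum>j<n. v j) = - 1}
     \<in> sets (Pi\<^sub>M {..<n} (\<lambda>_. lborel))"
    by (intro sets.sets_Collect_conj sets.sets_Collect_finite_All borel_measurable_le borel_measurable_eq
        borel_measurable_sum_coord borel_measurable_coord) auto
  also have "{v \<in> space (Pi\<^sub>M {..<n} (\<lambda>_. lborel :: real measure)). (\<forall>i\<in>{..<n}. v i \<le> 0) \<and> (\<Sum>j<n. v j) = - 1} = Delta n"
    by (auto simp: space_PiM PiE_def Pi_def Delta_def)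
  finally show ?thesis by (simp add: sets_PiM_lborel)
qed

lemma space_Delta_borel: "space (Delta_borel n) = Delta n"
  by (auto simp: Delta_borel_def space_restrict_space space_PiM_real Delta_def PiE_def)

lemma sets_eta: "sets (eta n) = sets (Delta_borel n)" and space_eta: "space (eta n) = Delta n"
  by (simp_all add: eta_def Delta_leb_def space_Delta_borel)

lemma sets_lam: "sets (lam n) = sets (Spec_borel n)" and space_lam: "space (lam n) = Spec n"
  by (simp_all add: lam_def space_Spec_borel)

lemma measurable_exp_vec: "exp_vec n \<in> Pi\<^sub>M {..<n} (\<lambda>_. lborel) \<rightarrow>\<^sub>M Pi\<^sub>M {..<n} (\<lambda>_. lborel)"
  unfolding exp_vec_def
proof (rule measurable_restrict)
  fix i assume "i \<in> {..<n}"
  then have [measurable]: "(\<lambda>u. u i) \<in> borel_measurable (Pi\<^sub>M {..<n} (\<lambda>_. lborel :: real measure))"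
    by (rule borel_measurable_coord)
  have "(\<lambda>u. exp (u i)) \<in> borel_measurable (Pi\<^sub>M {..<n} (\<lambda>_. lborel :: real measure))" by measurable
  then show "(\<lambda>u. exp (u i)) \<in> Pi\<^sub>M {..<n} (\<lambda>_. lborel :: real measure) \<rightarrow>\<^sub>M lborel" by (simp only: measurable_lborel1)
qed

lemma borel_measurable_Free_exp:
  assumes "t \<in> carrier (Free n)"
  shows "(\<lambda>u. t (exp_vec n u)) \<in> borel_measurable (Pi\<^sub>M {..<n} (\<lambda>_. borel))"
  using measurable_compose[OF measurable_exp_vec borel_measurable_Free[OF assms]]
    measurable_cong_sets[OF sets_PiM_lborel refl] by blast

lemma measurable_rho: "rho n \<in> Delta_borel n \<rightarrow>\<^sub>M Spec_borel n"
proof (rule measurable_Spec_borelI)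
  show "rho n \<in> space (Delta_borel n) \<rightarrow> Spec n"
    by (simp add: space_Delta_borel rho_Delta_in_Spec)
  fix a assume a: "a \<in> carrier (Free n)"
  have [measurable]: "(\<lambda>u. a (exp_vec n u)) \<in> borel_measurable (Delta_borel n)"
    unfolding Delta_borel_def by (intro measurable_restrict_space1 borel_measurable_Free_exp a)
  have "{u \<in> space (Delta_borel n). a (exp_vec n u) \<noteq> 1} \<in> sets (Delta_borel n)" by measurable
  then show "{u \<in> space (Delta_borel n). a \<notin> rho n u} \<in> sets (Delta_borel n)"
    using a by (simp add: rho_def)
qed

text \<open>The preimage of the subbasic set of \<open>a\<close> is the subbasic set of
  \<open>\<sigma> a\<close>.\<close>

lemma measurable_S_map:
  assumes "nontrivial_endo n \<sigma>"
  shows "S_map n \<sigma> \<in> Spec_borel n \<rightarrow>\<^sub>M Spec_borel n"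
proof (rule measurable_Spec_borelI)
  show "S_map n \<sigma> \<in> space (Spec_borel n) \<rightarrow> Spec n"
    using assms by (simp add: space_Spec_borel S_map_in_Spec)
  fix a assume a: "a \<in> carrier (Free n)"
  then have "\<sigma> a \<in> carrier (Free n)"
    using assms by (auto simp: nontrivial_endo_def hoop_hom_def)
  from sets_Spec_basic[OF this]
  show "{P \<in> space (Spec_borel n). a \<notin> S_map n \<sigma> P} \<in> sets (Spec_borel n)"
    using a by (simp add: space_Spec_borel S_map_def)
qed

section \<open>Recovering a point of the simplex from its filter\<close>

lemma Free_power:
  assumes "a \<in> carrier (Free n)"
  shows "(\<lambda>p\<in>cube n. a p ^ k) \<in> carrier (Free n)"
proof (induction k)
  case 0
  show ?case using Free_one[of n] by (simp only: power_0)
next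
  case (Suc k)
  have "(\<lambda>p\<in>cube n. a p ^ Suc k) = (\<lambda>p\<in>cube n. a p * (\<lambda>p\<in>cube n. a p ^ k) p)"
    by (auto simp: fun_eq_iff)
  with Free_mult[OF assms Suc] show ?case by (simp only:)
qed

text \<open>For \<open>k = n\<close> and \<open>u\<close> in the simplex this element has value
  \<open>exp (- 1)\<close> at \<open>exp_vec n u\<close>, a known unit against which single
  coordinates can be measured.\<close>

lemma Free_prod:
  "k \<le> n \<Longrightarrow> (\<lambda>p\<in>cube n. \<Prod>j<k. p j) \<in> carrier (Free n)"
proof (induction k)
  case 0
  show ?case using Free_one[of n] by (simp only: lessThan_0 prod.empty)
next
  case (Suc k)
  have "(\<lambda>p\<in>cube n. \<Prod>j<Suc k. p j) = (\<lambda>p\<in>cube n. (\<lambda>p\<in>cube n. \<Prod>j<k. p j) p * proj n k p)"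
    by (auto simp: fun_eq_iff proj_apply)
  with Free_mult[of _ n "proj n k"] Free_proj[of k n] Suc show ?case by (simp only: Suc_leD Suc_le_lessD)
qed

text \<open>At a point \<open>u\<close> of the simplex, \<open>cut n i (a, b)\<close> has value \<open>1\<close> iff \<open>- u i \<le> a / (b + 1)\<close>,
  so these elements recover the coordinates of \<open>u\<close> from the filter \<open>rho n u\<close>.\<close>

definition cut :: "nat \<Rightarrow> nat \<Rightarrow> nat \<times> nat \<Rightarrow> (nat \<Rightarrow> real) \<Rightarrow> real" where
  "cut n i k = (\<lambda>p\<in>cube n. min 1 (p i ^ Suc (snd k) / (\<Prod>j<n. p j) ^ fst k))"

text \<open>The default \<open>1\<close> leaves the infimum unchanged for filters of points, since
  \<open>- u i \<le> 1\<close> on the simplex. It lets the infimum run over a fixed countable index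
  set, which gives measurability in \<open>P\<close>.\<close>

definition rho_inv :: "nat \<Rightarrow> ((nat \<Rightarrow> real) \<Rightarrow> real) set \<Rightarrow> nat \<Rightarrow> real" where
  "rho_inv n P = (\<lambda>i\<in>{..<n}. - (INF k. if cut n i k \<in> P then real (fst k) / real (Suc (snd k)) else 1))"

lemma cut_in_Free:
  assumes "i < n"
  shows "cut n i k \<in> carrier (Free n)"
proof -
  define a where "a = (\<lambda>p\<in>cube n. (\<lambda>p\<in>cube n. \<Prod>j<n. p j) p ^ fst k)"
  define b where "b = (\<lambda>p\<in>cube n. proj n i p ^ Suc (snd k))"
  have "a \<in> carrier (Free n)" "b \<in> carrier (Free n)"
    unfolding a_def b_def using assms by (intro Free_power Free_prod Free_proj order_refl; simp)+
  then have "(\<lambda>p\<in>cube n. min 1 (b p / a p)) \<in> carrier (Free n)" by (rule Free_imp)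
  also have "(\<lambda>p\<in>cube n. min 1 (b p / a p)) = cut n i k"
    by (auto simp: fun_eq_iff cut_def a_def b_def proj_apply)
  finally show ?thesis .
qed

lemma cut_in_rho:
  assumes "u \<in> Delta n" "i < n"
  shows "cut n i k \<in> rho n u \<longleftrightarrow> - u i \<le> real (fst k) / real (Suc (snd k))"
proof -
  have p: "exp_vec n u \<in> cube n" using assms(1) by (intro exp_vec_in_cube Delta_nonpos)
  have "(\<Prod>j<n. exp_vec n u j) = exp (\<Sum>j<n. u j)"
    by (simp add: exp_vec_def exp_sum)
  also have "(\<Sum>j<n. u j) = - 1" using assms(1) by (simp add: Delta_def)
  finally have "cut n i k (exp_vec n u) = min 1 (exp (u i) ^ Suc (snd k) / exp (- 1) ^ fst k)"
    using p assms(2) by (simp only: cut_def restrict_apply if_True) (simp add: exp_vec_def)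
  also have "exp (u i) ^ Suc (snd k) / exp (- 1) ^ fst k = exp (real (Suc (snd k)) * u i + real (fst k))"
    by (simp only: exp_of_nat_mult[symmetric] exp_diff[symmetric]) simp
  finally have "cut n i k (exp_vec n u) = 1 \<longleftrightarrow> 0 \<le> real (Suc (snd k)) * u i + real (fst k)"
    by (auto simp only: min_def one_le_exp_iff split: if_splits) auto
  also have "\<dots> \<longleftrightarrow> - u i \<le> real (fst k) / real (Suc (snd k))"
    by (auto simp: field_simps)
  finally show ?thesis using cut_in_Free[OF assms(2)] by (simp add: rho_def)
qed

text \<open>By \<open>cut_in_rho\<close> the infimum is taken over the fractions that are at least
  \<open>- u i\<close>, together with \<open>1\<close>; density of the rationals makes it equal to
  \<open>- u i\<close>.\<close>

lemma rho_inv_rho: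
  assumes u: "u \<in> Delta n"
  shows "rho_inv n (rho n u) = u"
proof (rule extensionalityI[of _ "{..<n}"])
  show "u \<in> extensional {..<n}" using u by (simp add: Delta_def PiE_def)
  show "rho_inv n (rho n u) \<in> extensional {..<n}" by (simp add: rho_inv_def)
  fix i assume "i \<in> {..<n}"
  then have i: "i < n" by simp
  have nonpos: "u j \<le> 0" if "j < n" for j using u that by (simp add: Delta_def PiE_iff)
  \<comment> \<open>Nonpositive coordinates of sum \<open>- 1\<close> cannot lie below
    \<open>- 1\<close>; this makes the default \<open>1\<close> admissible.\<close>
  have "(\<Sum>j<n. u j) = u i + (\<Sum>j\<in>{..<n} - {i}. u j)" using i by (intro sum.remove) auto
  moreover have "(\<Sum>j\<in>{..<n} - {i}. u j) \<le> 0" using nonpos by (intro sum_nonpos) auto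
  ultimately have u1: "- u i \<le> 1" using u by (simp add: Delta_def)
  define F where "F k = (if cut n i k \<in> rho n u then real (fst k) / real (Suc (snd k)) else 1)" for k
  have F_ge: "- u i \<le> F k" for k using u1 by (simp add: F_def cut_in_rho[OF u i])
  then have bdd: "bdd_below (range F)" by (intro bdd_belowI[of _ "- u i"]) auto
  have "(INF k. F k) \<le> - u i"
  proof (rule dense_ge)
    fix y assume "- u i < y"
    then obtain b where b: "inverse (real (Suc b)) < y - (- u i)"
      using reals_Archimedean[of "y - (- u i)"] by auto
    \<comment> \<open>The numerator is rounded up, so \<open>a / (b + 1)\<close> exceeds
      \<open>- u i\<close> by less than \<open>1 / (b + 1)\<close>, hence stays below
      \<open>y\<close>.\<close>
    define a where "a = nat \<lceil>- u i * real (Suc b)\<rceil>"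
    have "real a = real_of_int \<lceil>- u i * real (Suc b)\<rceil>"
      using nonpos[OF i] by (simp add: a_def mult_nonpos_nonneg)
    then have "- u i * real (Suc b) \<le> real a" "real a < - u i * real (Suc b) + 1"
      by linarith+
    then have "- u i \<le> real a / real (Suc b)" "real a / real (Suc b) < (- u i * real (Suc b) + 1) / real (Suc b)"
      by (simp_all add: pos_le_divide_eq divide_strict_right_mono del: of_nat_Suc)
    moreover have "(- u i * real (Suc b) + 1) / real (Suc b) = - u i + inverse (real (Suc b))"
      by (simp add: field_simps del: of_nat_Suc)
    ultimately have "- u i \<le> real a / real (Suc b)" "real a / real (Suc b) < - u i + inverse (real (Suc b))"
      by simp_all
    then have "F (a, b) \<le> y"
      using b by (simp add: F_def cut_in_rho[OF u i])
    then show "(INF k. F k) \<le> y" by (rule cINF_lower2[OF bdd UNIV_I])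
  qed
  moreover have "- u i \<le> (INF k. F k)" using F_ge by (intro cINF_greatest) auto
  ultimately have "(INF k. F k) = - u i" by simp
  then show "rho_inv n (rho n u) i = u i"
    using i by (simp add: rho_inv_def F_def)
qed

lemma measurable_rho_inv: "rho_inv n \<in> Spec_borel n \<rightarrow>\<^sub>M Pi\<^sub>M {..<n} (\<lambda>_. borel)"
  unfolding rho_inv_def
proof (rule measurable_restrict)
  fix i assume "i \<in> {..<n}"
  then have i: "i < n" by simp
  have [measurable]: "Measurable.pred (Spec_borel n) (\<lambda>P. cut n i k \<in> P)" for k
    by (intro pred_mem_Spec cut_in_Free i)
  show "(\<lambda>P. - (INF k. if cut n i k \<in> P then real (fst k) / real (Suc (snd k)) else 1)) \<in> borel_measurable (Spec_borel n)"
    by (intro borel_measurable_uminus borel_measurable_cINF_real) measurable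
qed

section \<open>The range of \<open>rho n\<close> as a Borel set\<close>

definition Spec_pts :: "nat \<Rightarrow> ((nat \<Rightarrow> real) \<Rightarrow> real) set set" where
  "Spec_pts n = rho n ` Delta n"

lemma Spec_subset_carrier: "P \<in> Spec n \<Longrightarrow> P \<subseteq> carrier (Free n)"
  by (auto simp: Spec_def prime_filter_def hoop_filter_def)

text \<open>The equation \<open>P = rho n (rho_inv n P)\<close> is spelled out element by element,
  so that each condition is visibly Borel in \<open>P\<close>.\<close>

lemma Spec_pts_eq:
  "Spec_pts n = {P \<in> Spec n. rho_inv n P \<in> Delta n \<and>
     (\<forall>t\<in>carrier (Free n). t \<in> P \<longleftrightarrow> t (exp_vec n (rho_inv n P)) = 1)}" (is "_ = ?R")
proof (intro equalityI subsetI)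
  fix P assume "P \<in> Spec_pts n"
  then obtain u where "u \<in> Delta n" "P = rho n u" by (auto simp: Spec_pts_def)
  then show "P \<in> ?R" using rho_inv_rho[of u n] rho_Delta_in_Spec[of u n] by (simp add: rho_def)
next
  fix P assume P: "P \<in> ?R"
  then have "P = rho n (rho_inv n P)" using Spec_subset_carrier[of P n] by (auto simp: rho_def)
  with P show "P \<in> Spec_pts n" by (auto simp: Spec_pts_def)
qed

lemma sets_Spec_pts: "Spec_pts n \<in> sets (Spec_borel n)"
proof -
  note [measurable] = measurable_rho_inv sets_Delta pred_mem_Spec
  have "{P \<in> space (Spec_borel n). t \<in> P \<longleftrightarrow> t (exp_vec n (rho_inv n P)) = 1} \<in> sets (Spec_borel n)"
    if t: "t \<in> carrier (Free n)" for t
  proof -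
    have [measurable]: "(\<lambda>P. t (exp_vec n (rho_inv n P))) \<in> borel_measurable (Spec_borel n)"
      using measurable_compose[OF measurable_rho_inv borel_measurable_Free_exp[OF t]] .
    show ?thesis using t by measurable
  qed
  then have "{P \<in> space (Spec_borel n). \<forall>t\<in>carrier (Free n). t \<in> P \<longleftrightarrow> t (exp_vec n (rho_inv n P)) = 1} \<in> sets (Spec_borel n)"
    using countable_Free by (rule sets.sets_Collect_countable_All')
  moreover have "{P \<in> space (Spec_borel n). rho_inv n P \<in> Delta n} \<in> sets (Spec_borel n)"
    by measurable
  ultimately have "{P \<in> space (Spec_borel n). rho_inv n P \<in> Delta n \<and>
     (\<forall>t\<in>carrier (Free n). t \<in> P \<longleftrightarrow> t (exp_vec n (rho_inv n P)) = 1)} \<in> sets (Spec_borel n)"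
    by (intro sets.sets_Collect_conj)
  then show ?thesis by (simp only: Spec_pts_eq space_Spec_borel)
qed

section \<open>The measures on the simplex and on the spectrum\<close>

lemma cube_minus_one:
  assumes "n \<ge> 1"
  shows "cube n - {\<lambda>i\<in>{..<n}. 1} \<in> sets (Pi\<^sub>M {..<n} (\<lambda>_. lborel))"
    and "emeasure (Pi\<^sub>M {..<n} (\<lambda>_. lborel)) (cube n - {\<lambda>i\<in>{..<n}. 1}) = 1"
proof -
  interpret product_sigma_finite "\<lambda>_::nat. lborel :: real measure" by unfold_locales
  have one: "{\<lambda>i\<in>{..<n}. 1 :: real} = (\<Pi>\<^sub>E i\<in>{..<n}. {1})"
    by (auto simp: PiE_def Pi_def extensional_def fun_eq_iff)
  have "{\<lambda>i\<in>{..<n}. 1 :: real} \<in> null_sets (Pi\<^sub>M {..<n} (\<lambda>_. lborel))"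
  proof (rule null_setsI)
    \<comment> \<open>The measure of the removed point is a product of \<open>n\<close> zeros, which
      is \<open>0\<close> as \<open>n \<ge> 1\<close>.\<close>
    have "emeasure (Pi\<^sub>M {..<n} (\<lambda>_. lborel)) (\<Pi>\<^sub>E i\<in>{..<n}. {1 :: real}) = (\<Prod>i<n. emeasure lborel {1 :: real})"
      by (rule emeasure_PiM) auto
    then show "emeasure (Pi\<^sub>M {..<n} (\<lambda>_. lborel)) {\<lambda>i\<in>{..<n}. 1 :: real} = 0"
      unfolding one using assms by (simp add: power_0_left)
    show "{\<lambda>i\<in>{..<n}. 1 :: real} \<in> sets (Pi\<^sub>M {..<n} (\<lambda>_. lborel))"
      unfolding one by (rule sets_PiM_I_finite) auto
  qed
  moreover have "emeasure (Pi\<^sub>M {..<n} (\<lambda>_. lborel)) (cube n) = 1"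
    unfolding cube_def by (subst emeasure_PiM) auto
  ultimately show "cube n - {\<lambda>i\<in>{..<n}. 1} \<in> sets (Pi\<^sub>M {..<n} (\<lambda>_. lborel))"
    "emeasure (Pi\<^sub>M {..<n} (\<lambda>_. lborel)) (cube n - {\<lambda>i\<in>{..<n}. 1}) = 1"
    using sets_cube[of n] by (auto simp: emeasure_Diff_null_set)
qed

lemma measurable_pi_map:
  "pi_map n \<in> restrict_space (Pi\<^sub>M {..<n} (\<lambda>_. lborel)) (cube n - {\<lambda>i\<in>{..<n}. 1}) \<rightarrow>\<^sub>M Spec_borel n"
proof (rule measurable_Spec_borelI)
  let ?M = "restrict_space (Pi\<^sub>M {..<n} (\<lambda>_. lborel :: real measure)) (cube n - {\<lambda>i\<in>{..<n}. 1})"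
  show "pi_map n \<in> space ?M \<rightarrow> Spec n"
  proof
    fix p assume "p \<in> space ?M"
    then have p: "p \<in> cube n" "p \<noteq> (\<lambda>i\<in>{..<n}. 1)" by (auto simp: space_restrict_space)
    have "\<exists>i<n. p i \<noteq> 1"
    proof (rule ccontr)
      assume "\<not> (\<exists>i<n. p i \<noteq> 1)"
      then have "p = (\<lambda>i\<in>{..<n}. 1)"
        using p(1) by (intro extensionalityI[of _ "{..<n}"]) (auto simp: cube_def PiE_def)
      with p(2) show False ..
    qed
    then show "pi_map n p \<in> Spec n" using p(1) unfolding pi_map_def by (auto intro: point_in_Spec)
  qed
  fix a assume a: "a \<in> carrier (Free n)"
  have [measurable]: "a \<in> borel_measurable ?M"
    by (intro measurable_restrict_space1 borel_measurable_Free a)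
  have "{p \<in> space ?M. a p \<noteq> 1} \<in> sets ?M" by measurable
  then show "{p \<in> space ?M. a \<notin> pi_map n p} \<in> sets ?M" using a by (simp add: pi_map_def)
qed

section \<open>Comparison of \<open>lam n\<close> with \<open>eta n\<close> through
  \<open>rho n\<close>\<close>

lemma Delta_chart_in_Delta:
  assumes "v \<in> {..<m} \<rightarrow>\<^sub>E {..0}" "- 1 \<le> (\<Sum>j<m. v j)"
  shows "Delta_chart (Suc m) v \<in> Delta (Suc m)"
proof -
  have "Delta_chart (Suc m) v i \<le> 0" if "i < Suc m" for i
    using assms that by (auto simp: Delta_chart_def PiE_iff less_Suc_eq)
  moreover have "Delta_chart (Suc m) v \<in> extensional {..<Suc m}"
    unfolding Delta_chart_def by (rule restrict_extensional)
  ultimately show ?thesis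
    using sum_Delta_chart[of m v] by (simp add: Delta_def PiE_iff)
qed

text \<open>Puts \<open>Delta_leb\<close> into the form of the simplex factor in
  \<open>nn_integral_polar\<close>.\<close>

lemma emeasure_Delta_leb:
  assumes "A \<in> sets (Delta_borel (Suc m))"
  shows "emeasure (Delta_leb (Suc m)) A =
    (\<integral>\<^sup>+v. indicator A (Delta_chart (Suc m) v) * indicator {v \<in> {..<m} \<rightarrow>\<^sub>E {..0}. - 1 \<le> (\<Sum>j<m. v j)} v \<partial>Pi\<^sub>M {..<m} (\<lambda>_. lborel))"
proof -
  define D where "D = {v \<in> {..<m} \<rightarrow>\<^sub>E {..0::real}. - 1 \<le> (\<Sum>j<m. v j)}"
  let ?P = "Pi\<^sub>M {..<m} (\<lambda>_. lborel :: real measure)"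
  have D: "D \<in> sets ?P" unfolding D_def by (rule sets_Delta_chart_domain)
  have D': "D \<inter> space ?P \<in> sets ?P" using D by auto
  have chart: "Delta_chart (Suc m) \<in> restrict_space ?P D \<rightarrow>\<^sub>M Delta_borel (Suc m)"
    unfolding Delta_borel_def
  proof (rule measurable_restrict_space2)
    show "Delta_chart (Suc m) \<in> space (restrict_space ?P D) \<rightarrow> Delta (Suc m)"
      using D Delta_chart_in_Delta by (auto simp: space_restrict_space D_def)
    show "Delta_chart (Suc m) \<in> restrict_space ?P D \<rightarrow>\<^sub>M Pi\<^sub>M {..<Suc m} (\<lambda>_. borel)"
      using measurable_restrict_space1[OF measurable_Delta_chart[of m], of D]
        measurable_cong_sets[OF refl sets_PiM_lborel] by blast
  qed
  have "emeasure (Delta_leb (Suc m)) A =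
    emeasure (restrict_space ?P D) (Delta_chart (Suc m) -` A \<inter> space (restrict_space ?P D))"
    unfolding Delta_leb_def diff_Suc_1 D_def[symmetric]
    by (rule emeasure_distr[OF chart assms])
  also have "\<dots> = emeasure ?P (Delta_chart (Suc m) -` A \<inter> space (restrict_space ?P D))"
    by (intro emeasure_restrict_space D') (auto simp: space_restrict_space)
  also have "\<dots> = (\<integral>\<^sup>+v. indicator (Delta_chart (Suc m) -` A \<inter> space (restrict_space ?P D)) v \<partial>?P)"
    using measurable_sets[OF chart assms] D' by (intro nn_integral_indicator[symmetric]) (simp add: sets_restrict_space_iff)
  also have "\<dots> = (\<integral>\<^sup>+v. indicator A (Delta_chart (Suc m) v) * indicator D v \<partial>?P)"
    by (intro nn_integral_cong) (auto simp: space_restrict_space split: split_indicator)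
  finally show ?thesis unfolding D_def .
qed

text \<open>The substitution \<open>p = exp y\<close> carries the integral from the cube to the
  negative orthant. There the indicator of the preimage of \<open>B\<close> is constant along rays,
  so \<open>nn_integral_polar\<close> applies. The radial integral remains as a constant factor, to
  be fixed by normalization.\<close>

lemma emeasure_lam_eq_Delta_leb:
  assumes B: "B \<in> sets (Spec_borel (Suc m))"
  shows "emeasure (lam (Suc m)) B =
    emeasure (Delta_leb (Suc m)) (rho (Suc m) -` B \<inter> Delta (Suc m)) *
    (\<integral>\<^sup>+c. ennreal (exp (- c) * c ^ m) * indicator {0<..} c \<partial>lborel)"
proof -
  let ?n = "Suc m"
  let ?P = "Pi\<^sub>M {..<?n} (\<lambda>_. lborel :: real measure)"
  define one :: "nat \<Rightarrow> real" where "one = (\<lambda>i\<in>{..<?n}. 1)"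
  define C where "C = cube ?n - {one}"
  have C: "C \<in> sets ?P" "C \<inter> space ?P \<in> sets ?P"
    using cube_minus_one(1)[of ?n] unfolding C_def one_def by auto
  define E where "E = pi_map ?n -` B \<inter> space (restrict_space ?P C)"
  have pi: "pi_map ?n \<in> restrict_space ?P C \<rightarrow>\<^sub>M Spec_borel ?n"
    unfolding C_def one_def by (rule measurable_pi_map)
  have E_sub: "E \<subseteq> C" by (auto simp: E_def space_restrict_space)
  have [measurable]: "E \<in> sets ?P"
    using measurable_sets[OF pi B] C(2) by (simp add: E_def sets_restrict_space_iff)
  note [measurable] = measurable_exp_vec
  have E_iff: "p \<in> E \<longleftrightarrow> p \<in> C \<and> pi_map ?n p \<in> B" for p
    using C(1)[THEN sets.sets_into_space] by (auto simp: E_def space_restrict_space)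
  \<comment> \<open>The removed point of the cube corresponds to \<open>y = 0\<close>; away from it,
    membership in \<open>E\<close> depends only on the filter of \<open>y\<close>.\<close>
  have E_exp: "exp_vec ?n y \<in> E \<longleftrightarrow> rho ?n y \<in> B \<and> (\<exists>i<?n. y i \<noteq> 0)" if y: "y \<in> {..<?n} \<rightarrow>\<^sub>E {..0}" for y
  proof -
    have "exp_vec ?n y = one \<longleftrightarrow> (\<forall>i<?n. y i = 0)"
      by (auto simp: exp_vec_def one_def fun_eq_iff)
    then show ?thesis
      using exp_vec_in_cube[OF y] by (auto simp: E_iff C_def pi_map_def rho_def)
  qed
  have "emeasure (lam ?n) B = emeasure (restrict_space ?P C) E"
    unfolding lam_def E_def C_def one_def by (rule emeasure_distr[OF measurable_pi_map B])
  also have "\<dots> = emeasure ?P E"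
    by (rule emeasure_restrict_space[OF C(2) E_sub])
  \<comment> \<open>The inserted product is \<open>1\<close> on \<open>E\<close>, which lies in the
    cube; it supplies the weights for \<open>nn_integral_PiM_subst\<close>.\<close>
  also have "\<dots> = (\<integral>\<^sup>+p. indicator E p * (\<Prod>i<?n. indicator {0<..1} (p i)) \<partial>?P)"
  proof (subst nn_integral_indicator[symmetric], measurable, intro nn_integral_cong)
    fix p
    have "(\<Prod>i<?n. indicator {0<..1} (p i)) = (1 :: ennreal)" if "p \<in> E"
      using that E_sub cube_mem[of p ?n] by (intro prod.neutral) (auto simp: C_def)
    then show "indicator E p = indicator E p * (\<Prod>i<?n. indicator {0<..1} (p i) :: ennreal)"
      by (auto split: split_indicator)
  qed
  also have "\<dots> = (\<integral>\<^sup>+y. indicator E (\<lambda>i\<in>{..<?n}. exp (y i)) *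
      (\<Prod>i<?n. ennreal (exp (y i)) * indicator {..0} (y i)) \<partial>?P)"
    by (rule nn_integral_PiM_subst[OF _ _ _ nn_integral_exp_subst]) auto
  also have "\<dots> = (\<integral>\<^sup>+y. indicator E (exp_vec ?n y) *
      (\<Prod>i<?n. ennreal (exp (y i)) * indicator {..0} (y i)) \<partial>?P)"
    unfolding exp_vec_def ..
  also have "\<dots> =
    (\<integral>\<^sup>+v. indicator E (exp_vec ?n (Delta_chart ?n v)) *
        indicator {v \<in> {..<m} \<rightarrow>\<^sub>E {..0}. - 1 \<le> (\<Sum>j<m. v j)} v \<partial>Pi\<^sub>M {..<m} (\<lambda>_. lborel)) *
    (\<integral>\<^sup>+c. ennreal (exp (- c) * c ^ m) * indicator {0<..} c \<partial>lborel)"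
  proof (rule nn_integral_polar)
    show "(\<lambda>y. indicator E (exp_vec ?n y)) \<in> borel_measurable ?P" by measurable
    fix c :: real and y :: "nat \<Rightarrow> real" assume c: "c > 0" and y: "y \<in> {..<?n} \<rightarrow>\<^sub>E {..0}"
    define w where "w = (\<lambda>i\<in>{..<?n}. c * y i)"
    have w_eq: "w i = c * y i" if "i < ?n" for i using that by (simp add: w_def)
    have "w \<in> extensional {..<?n}" unfolding w_def by (rule restrict_extensional)
    then have w: "w \<in> {..<?n} \<rightarrow>\<^sub>E {..0}" using c y by (simp add: PiE_iff w_eq mult_le_0_iff)
    have "rho ?n w = rho ?n y" unfolding w_def by (rule rho_scale[OF y c])
    moreover have "(\<exists>i<?n. w i \<noteq> 0) \<longleftrightarrow> (\<exists>i<?n. y i \<noteq> 0)" using c by (simp add: w_eq cong: conj_cong)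
    ultimately have "exp_vec ?n w \<in> E \<longleftrightarrow> exp_vec ?n y \<in> E" by (simp only: E_exp[OF w] E_exp[OF y])
    then show "indicator E (exp_vec ?n (\<lambda>i\<in>{..<?n}. c * y i)) = (indicator E (exp_vec ?n y) :: ennreal)"
      unfolding w_def[symmetric] by (simp only: indicator_def)
  qed
  also have "(\<integral>\<^sup>+v. indicator E (exp_vec ?n (Delta_chart ?n v)) *
        indicator {v \<in> {..<m} \<rightarrow>\<^sub>E {..0}. - 1 \<le> (\<Sum>j<m. v j)} v \<partial>Pi\<^sub>M {..<m} (\<lambda>_. lborel)) =
    emeasure (Delta_leb ?n) (rho ?n -` B \<inter> Delta ?n)"
  proof (subst emeasure_Delta_leb)
    show "rho ?n -` B \<inter> Delta ?n \<in> sets (Delta_borel ?n)"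
      using measurable_sets[OF measurable_rho B] by (simp add: space_Delta_borel)
    show "(\<integral>\<^sup>+v. indicator E (exp_vec ?n (Delta_chart ?n v)) *
        indicator {v \<in> {..<m} \<rightarrow>\<^sub>E {..0}. - 1 \<le> (\<Sum>j<m. v j)} v \<partial>Pi\<^sub>M {..<m} (\<lambda>_. lborel)) =
      (\<integral>\<^sup>+v. indicator (rho ?n -` B \<inter> Delta ?n) (Delta_chart ?n v) *
        indicator {v \<in> {..<m} \<rightarrow>\<^sub>E {..0}. - 1 \<le> (\<Sum>j<m. v j)} v \<partial>Pi\<^sub>M {..<m} (\<lambda>_. lborel))"
    proof (intro nn_integral_cong)
      fix v
      define x where "x = Delta_chart ?n v"
      show "indicator E (exp_vec ?n (Delta_chart ?n v)) *
          indicator {v \<in> {..<m} \<rightarrow>\<^sub>E {..0}. - 1 \<le> (\<Sum>j<m. v j)} v =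
        (indicator (rho ?n -` B \<inter> Delta ?n) (Delta_chart ?n v) *
          indicator {v \<in> {..<m} \<rightarrow>\<^sub>E {..0}. - 1 \<le> (\<Sum>j<m. v j)} v :: ennreal)"
      proof (cases "v \<in> {v \<in> {..<m} \<rightarrow>\<^sub>E {..0}. - 1 \<le> (\<Sum>j<m. v j)}")
        case True
        then have x: "x \<in> Delta ?n" unfolding x_def by (intro Delta_chart_in_Delta) auto
        \<comment> \<open>The simplex does not contain the zero vector, so the removed point plays
          no part on it.\<close>
        have "(\<Sum>i<?n. x i) \<noteq> 0" using x by (simp add: Delta_def)
        then have "\<exists>i<?n. x i \<noteq> 0" by (meson lessThan_iff sum.neutral)
        then have "exp_vec ?n x \<in> E \<longleftrightarrow> x \<in> rho ?n -` B \<inter> Delta ?n"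
          using x E_exp[OF Delta_nonpos[OF x]] by simp
        then show ?thesis unfolding x_def[symmetric] by (simp only: indicator_def)
      next
        case False
        then show ?thesis by (simp only: indicator_simps mult_zero_right simp_thms)
      qed
    qed
  qed
  finally show ?thesis .
qed

text \<open>Evaluating the preceding identity on all of \<open>Spec n\<close>, which has mass
  \<open>1\<close>, shows that the radial factor \<open>K\<close> is the reciprocal of the mass
  \<open>V\<close> of the simplex, that is, the normalization in \<open>eta\<close>.\<close>

lemma emeasure_lam:
  assumes n: "n \<ge> 1" and B: "B \<in> sets (Spec_borel n)"
  shows "emeasure (lam n) B = emeasure (eta n) (rho n -` B \<inter> Delta n)"
proof -
  obtain m where m: "n = Suc m" using n by (cases n) auto
  define K where "K = (\<integral>\<^sup>+c. ennreal (exp (- c) * c ^ m) * indicator {0<..} c \<partial>lborel)"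
  define V where "V = emeasure (Delta_leb n) (Delta n)"
  have lam: "emeasure (lam n) B = emeasure (Delta_leb n) (rho n -` B \<inter> Delta n) * K"
    if "B \<in> sets (Spec_borel n)" for B
    using emeasure_lam_eq_Delta_leb that unfolding m K_def .
  have top: "Spec n \<in> sets (Spec_borel n)" using sets.top[of "Spec_borel n"] by (simp add: space_Spec_borel)
  have "rho n -` Spec n \<inter> Delta n = Delta n" using rho_Delta_in_Spec by auto
  then have "emeasure (lam n) (Spec n) = V * K" using lam[OF top] by (simp add: V_def)
  moreover have "emeasure (lam n) (Spec n) = 1"
  proof -
    let ?P = "Pi\<^sub>M {..<n} (\<lambda>_. lborel :: real measure)" and ?C = "cube n - {\<lambda>i\<in>{..<n}. 1}"
    have C: "?C \<in> sets ?P" "?C \<subseteq> space ?P"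
      using cube_minus_one(1)[OF n] sets.sets_into_space by blast+
    have sp: "space (restrict_space ?P ?C) = ?C"
      unfolding space_restrict_space using C(2) by blast
    have "emeasure (lam n) (Spec n) = emeasure (restrict_space ?P ?C) (pi_map n -` Spec n \<inter> space (restrict_space ?P ?C))"
      unfolding lam_def by (rule emeasure_distr[OF measurable_pi_map top])
    also have "pi_map n -` Spec n \<inter> space (restrict_space ?P ?C) = ?C"
      using measurable_space[OF measurable_pi_map[of n]] unfolding sp space_Spec_borel by blast
    also have "emeasure (restrict_space ?P ?C) ?C = emeasure ?P ?C"
      using C by (intro emeasure_restrict_space) auto
    finally show ?thesis using cube_minus_one(2)[OF n] by simp
  qed
  ultimately have VK: "V * K = 1" by simp
  \<comment> \<open>In \<open>ennreal\<close> a product with \<open>0\<close> is \<open>0\<close>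
    and one with \<open>\<infinity>\<close> is \<open>0\<close> or \<open>\<infinity>\<close>, never
    \<open>1\<close>.\<close>
  then have "V \<noteq> 0" "V \<noteq> \<infinity>" by (auto simp: ennreal_top_mult split: if_splits)
  then have "V / V = 1" by (intro ennreal_divide_self) (simp_all add: less_top)
  have "inverse V = inverse V * (V * K)" unfolding VK by simp
  also have "\<dots> = (V / V) * K" by (simp only: divide_ennreal_def ac_simps)
  finally have K: "K = inverse V" unfolding \<open>V / V = 1\<close> by simp
  have "Delta n \<in> sets (Delta_borel n)"
    using sets.top[of "Delta_borel n"] by (simp add: space_Delta_borel)
  moreover have A: "rho n -` B \<inter> Delta n \<in> sets (Delta_borel n)"
    using measurable_sets[OF measurable_rho B] by (simp add: space_Delta_borel)
  ultimately have "emeasure (eta n) (rho n -` B \<inter> Delta n) =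
    emeasure (Delta_leb n) (Delta n \<inter> (rho n -` B \<inter> Delta n)) / V"
    unfolding eta_def V_def by (intro emeasure_uniform_measure) (simp_all add: Delta_leb_def)
  also have "Delta n \<inter> (rho n -` B \<inter> Delta n) = rho n -` B \<inter> Delta n" by blast
  finally show ?thesis using lam[OF B] by (simp add: K divide_ennreal_def)
qed

section \<open>Isomorphism of the two systems and transport of nonsingularity\<close>

theorem theorem4p3:
  fixes n :: nat
    and \<sigma> :: "((nat \<Rightarrow> real) \<Rightarrow> real) \<Rightarrow> (nat \<Rightarrow> real) \<Rightarrow> real"
  assumes "n \<ge> 1"
    and "nontrivial_endo n \<sigma>"
  shows "(nonsingular (eta n) (s_tilde n \<sigma>) \<longleftrightarrow> nonsingular (lam n) (S_map n \<sigma>)) \<and>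
    (nonsingular (eta n) (s_tilde n \<sigma>) \<or> nonsingular (lam n) (S_map n \<sigma>) \<longrightarrow>
      isomorphic_under (eta n) (s_tilde n \<sigma>) (lam n) (S_map n \<sigma>) (rho n))"
proof -
  note lam = emeasure_lam[OF assms(1)]
  note st = S_map_rho[OF assms(2)]
  have rho_sets: "rho n -` B \<inter> Delta n \<in> sets (eta n)" if "B \<in> sets (Spec_borel n)" for B
    using measurable_sets[OF measurable_rho that] by (simp add: space_Delta_borel sets_eta)
  have null_iff: "B \<in> null_sets (lam n) \<longleftrightarrow> rho n -` B \<inter> Delta n \<in> null_sets (eta n)"
    if "B \<in> sets (Spec_borel n)" for B
    using lam[OF that] rho_sets[OF that] that by (simp add: null_sets_def sets_lam)
  have conj: "rho n -` (S_map n \<sigma> -` B \<inter> Spec n) \<inter> Delta n = s_tilde n \<sigma> -` (rho n -` B \<inter> Delta n) \<inter> Delta n" for B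
    using st rho_Delta_in_Spec by auto
  have inj: "inj_on (rho n) (Delta n)" using rho_inv_rho by (intro inj_on_inverseI)
  \<comment> \<open>An image under \<open>rho n\<close> is a preimage under its Borel left inverse,
    cut down to the Borel set \<open>Spec_pts n\<close>; hence images of Borel sets are
    Borel.\<close>
  have image: "rho n ` A = rho_inv n -` A \<inter> Spec_pts n" if "A \<subseteq> Delta n" for A
    using that rho_inv_rho unfolding Spec_pts_def by (auto simp: image_iff)
  have inv_meas: "rho_inv n \<in> restrict_space (lam n) (Spec_pts n) \<rightarrow>\<^sub>M restrict_space (eta n) (Delta n)"
  proof -
    have "rho_inv n \<in> restrict_space (lam n) (Spec_pts n) \<rightarrow>\<^sub>M Delta_borel n"
      unfolding Delta_borel_def
    proof (rule measurable_restrict_space2)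
      show "rho_inv n \<in> space (restrict_space (lam n) (Spec_pts n)) \<rightarrow> Delta n"
        by (auto simp: space_restrict_space Spec_pts_eq)
      have "rho_inv n \<in> lam n \<rightarrow>\<^sub>M Pi\<^sub>M {..<n} (\<lambda>_. borel)"
        using measurable_rho_inv measurable_cong_sets[OF sets_lam refl] by blast
      then show "rho_inv n \<in> restrict_space (lam n) (Spec_pts n) \<rightarrow>\<^sub>M Pi\<^sub>M {..<n} (\<lambda>_. borel)"
        by (rule measurable_restrict_space1)
    qed
    then have "rho_inv n \<in> restrict_space (lam n) (Spec_pts n) \<rightarrow>\<^sub>M eta n"
      using measurable_cong_sets[OF refl sets_eta] by blast
    then show ?thesis
      by (intro measurable_restrict_space2) (auto simp: space_restrict_space Spec_pts_eq)
  qed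
  have Delta_eta: "Delta n \<in> sets (eta n)" using sets.top[of "eta n"] by (simp add: space_eta)
  have image_sets: "rho n ` A \<in> sets (Spec_borel n)" if "A \<in> sets (eta n)" for A
  proof -
    have A: "A \<subseteq> Delta n" using sets.sets_into_space[OF that] by (simp add: space_eta)
    have "A \<in> sets (restrict_space (eta n) (Delta n))"
      using that A Delta_eta by (simp add: sets_restrict_space_iff)
    from measurable_sets[OF inv_meas this] have "rho_inv n -` A \<inter> Spec_pts n \<in> sets (lam n)"
      using sets_Spec_pts[of n] sets.sets_into_space[OF sets_Spec_pts[of n]]
      by (simp add: sets_restrict_space_iff space_restrict_space space_lam sets_lam space_Spec_borel Int_absorb2 Int_absorb1)
    then show ?thesis by (simp add: image[OF A] sets_lam)
  qed
  have iso: "isomorphic_under (eta n) (s_tilde n \<sigma>) (lam n) (S_map n \<sigma>) (rho n)"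
    unfolding isomorphic_under_def
  proof (intro bexI conjI)
    show "Delta n \<in> sets (eta n)" by (rule Delta_eta)
    show pts: "Spec_pts n \<in> sets (lam n)" by (simp add: sets_lam sets_Spec_pts)
    show "space (eta n) - Delta n \<in> null_sets (eta n)" by (simp add: space_eta)
    \<comment> \<open>The range has full measure because its complement has empty preimage in the
      simplex.\<close>
    have "rho n -` (Spec n - Spec_pts n) \<inter> Delta n = {}" by (auto simp: Spec_pts_def)
    moreover have "Spec n - Spec_pts n \<in> sets (Spec_borel n)"
      using sets.compl_sets[OF sets_Spec_pts[of n]] by (simp add: space_Spec_borel)
    ultimately show "space (lam n) - Spec_pts n \<in> null_sets (lam n)"
      by (simp add: null_iff space_lam)
    show "s_tilde n \<sigma> ` Delta n \<subseteq> Delta n" using st(1) by auto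
    show "S_map n \<sigma> ` Spec_pts n \<subseteq> Spec_pts n" using st by (auto simp: Spec_pts_def)
    show bij: "bij_betw (rho n) (Delta n) (Spec_pts n)"
      using inj by (simp add: bij_betw_def Spec_pts_def)
    have "rho n \<in> eta n \<rightarrow>\<^sub>M lam n"
      using measurable_rho measurable_cong_sets[OF sets_eta sets_lam] by blast
    then show "rho n \<in> restrict_space (eta n) (Delta n) \<rightarrow>\<^sub>M restrict_space (lam n) (Spec_pts n)"
      by (intro measurable_restrict_space3) (auto simp: Spec_pts_def)
    have "the_inv_into (Delta n) (rho n) P = rho_inv n P" if "P \<in> Spec_pts n" for P
      using that inj rho_inv_rho by (auto simp: Spec_pts_def the_inv_into_f_f)
    then show "the_inv_into (Delta n) (rho n) \<in> restrict_space (lam n) (Spec_pts n) \<rightarrow>\<^sub>M restrict_space (eta n) (Delta n)"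
      using inv_meas by (subst measurable_cong[where g = "rho_inv n"]) (auto simp: space_restrict_space)
    show "\<forall>B\<in>sets (lam n). B \<subseteq> Spec_pts n \<longrightarrow> emeasure (eta n) (rho n -` B \<inter> Delta n) = emeasure (lam n) B"
      by (simp add: lam sets_lam)
    show "\<forall>u\<in>Delta n. rho n (s_tilde n \<sigma> u) = S_map n \<sigma> (rho n u)"
      using st(2) by simp
  qed
  have "nonsingular (eta n) (s_tilde n \<sigma>) \<longleftrightarrow> nonsingular (lam n) (S_map n \<sigma>)"
  proof
    assume ns: "nonsingular (eta n) (s_tilde n \<sigma>)"
    show "nonsingular (lam n) (S_map n \<sigma>)"
      unfolding nonsingular_def
    proof
      fix B assume B: "B \<in> null_sets (lam n)"
      then have Bs: "B \<in> sets (Spec_borel n)" by (auto simp: sets_lam)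
      have S: "S_map n \<sigma> -` B \<inter> Spec n \<in> sets (Spec_borel n)"
        using measurable_sets[OF measurable_S_map[OF assms(2)] Bs] by (simp add: space_Spec_borel)
      \<comment> \<open>Null sets of \<open>lam n\<close> are those with null preimage under
        \<open>rho n\<close>, and by \<open>conj\<close> this preimage intertwines the two
        maps.\<close>
      show "S_map n \<sigma> -` B \<inter> space (lam n) \<in> null_sets (lam n)"
        using ns B unfolding space_lam null_iff[OF S] null_iff[OF Bs] conj
        by (auto simp: nonsingular_def space_eta)
    qed
  next
    assume ns: "nonsingular (lam n) (S_map n \<sigma>)"
    show "nonsingular (eta n) (s_tilde n \<sigma>)"
      unfolding nonsingular_def
    proof
      fix A assume A: "A \<in> null_sets (eta n)"
      then have As: "A \<in> sets (eta n)" by auto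
      then have sub: "A \<subseteq> Delta n" using sets.sets_into_space by (fastforce simp: space_eta)
      \<comment> \<open>For this direction a null set has to be pushed forward; injectivity of
        \<open>rho n\<close> ensures that pulling its image back returns exactly
        \<open>A\<close>.\<close>
      have pre: "rho n -` rho n ` A \<inter> Delta n = A"
        using sub inj by (auto dest: inj_onD)
      have "rho n ` A \<in> null_sets (lam n)"
        using A by (simp add: null_iff[OF image_sets[OF As]] pre)
      then have "S_map n \<sigma> -` (rho n ` A) \<inter> Spec n \<in> null_sets (lam n)"
        using ns by (auto simp: nonsingular_def space_lam)
      moreover from this have S: "S_map n \<sigma> -` (rho n ` A) \<inter> Spec n \<in> sets (Spec_borel n)"
        by (auto simp: sets_lam)
      ultimately show "s_tilde n \<sigma> -` A \<inter> space (eta n) \<in> null_sets (eta n)"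
        by (simp only: null_iff[OF S] conj pre space_eta)
    qed
  qed
  with iso show ?thesis by blast
qed

end
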